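(* Let $\ell$ and $m$ be integers with $1\le m<\ell\le n-1$, let $T_\ell$ and $T_m$ be the random-scan Gibbs kernels targeting $\Pi$ that update, respectively, $\ell$ and $m$ components at a time, and let $Q_{\Lambda,y}$ be the kernels defined in the context. Suppose that there exists a constant $c_1\in[0,1]$ such that $$c_1\le\frac{\mathcal E_{Q_{\Lambda,y}}(g)}{\|g\|_{\Pi_{\Lambda,y}}^2}$$ for every $\Lambda\subset\{1,\dots,n\}$ with $|\Lambda|=\ell$, $M_{-\Lambda}$-a.e. $y\in\mathsf X_{-\Lambda}$, and every $g\in L_0^2(\Pi_{\Lambda,y})\setminus\{0\}$. Then $$c_1(1-\|T_\ell\|_\Pi)\le1-\|T_m\|_\Pi\le1-\|T_\ell\|_\Pi.$$ Moreover, if $\|T_\ell\|_\Pi<1$ and $c_1>0$, then for every $f\in L_0^2(\Pi)$, $$\mathrm{var}_{T_\ell}(f)\le\mathrm{var}_{T_m}(f)\le c_1^{-1}\,\mathrm{var}_{T_\ell}(f)+(c_1^{-1}-1)\|f\|_\Pi^2.$$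
   Context: $L^2$ conventions. For a probability measure $\omega$, $L_0^2(\omega)$ is the real Hilbert space of square-integrable functions with $\omega$-mean zero (modulo a.e. equality), with inner product $\langle\cdot,\cdot\rangle_\omega$ and norm $\|\cdot\|_\omega$. For a Markov kernel $K$ reversible with respect to $\omega$, $\|K\|_\omega\in[0,1]$ is its operator norm on $L_0^2(\omega)$, and for $f\in L_0^2(\omega)$, $\mathcal E_K(f)=\|f\|_\omega^2-\langle f,Kf\rangle_\omega=\tfrac12\int\int\omega(dy)K(y,dy')[f(y)-f(y')]^2$. The asymptotic variance of $f$ is $\mathrm{var}_K(f)=\lim_{t\to\infty}t^{-1}\,\mathrm{var}\big[\sum_{s=1}^t f(X(s))\big]$, where $(X(s))_{s\ge0}$ is the chain with kernel $K$ and $X(0)\sim\omega$; when $\|K\|_\omega<1$ and $f\in L_0^2(\omega)$ it equals $2\langle f,(I-K)^{-1}f\rangle_\omega-\|f\|_\omega^2$. Setting. $\mathsf X=\mathsf X_1\times\cdots\times\mathsf X_n$ is a product of Polish spaces with Borel $\sigma$-algebras, and $\Pi$ is a probability measure on $\mathsf X$. Write $[n]=\{1,\dots,n\}$. For $\Lambda\subset[n]$ with $1\le|\Lambda|\le n-1$ and $x\in\mathsf X$, let $x_\Lambda=(x_i)_{i\in\Lambda}$, $x_{-\Lambda}=(x_i)_{i\notin\Lambda}$, $\mathsf X_\Lambda=\{x_\Lambda:x\in\mathsf X\}$, $\mathsf X_{-\Lambda}=\{x_{-\Lambda}:x\in\mathsf X\}$. For $X\sim\Pi$, $M_{-\Lambda}$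 is the distribution of $X_{-\Lambda}$ and $\Pi_{\Lambda,y}$ is the conditional distribution of $X_\Lambda$ given $X_{-\Lambda}=y$. With $\delta$ denoting a point mass, for $r\in\{1,\dots,n-1\}$, $$T_r(x,dx')=\binom nr^{-1}\sum_{\Lambda\subset[n],\,|\Lambda|=r}\Pi_{\Lambda,x_{-\Lambda}}(dx'_\Lambda)\,\delta_{x_{-\Lambda}}(dx'_{-\Lambda}).$$ For $|\Lambda|=\ell$ and $y\in\mathsf X_{-\Lambda}$, $Q_{\Lambda,y}$ is the Markov kernel on $\mathsf X_\Lambda$ satisfying $$Q_{\Lambda,x_{-\Lambda}}(x_\Lambda,dx_\Lambda')=\binom\ell m^{-1}\sum_{\Gamma\subset\Lambda,\,|\Gamma|=m}\Pi_{\Gamma,x_{-\Gamma}}(dx'_\Gamma)\,\delta_{x_{\Lambda\setminus\Gamma}}(dx'_{\Lambda\setminus\Gamma});$$ for $M_{-\Lambda}$-a.e. $y$ it is reversible with respect to $\Pi_{\Lambda,y}$ (it is the random-scan Gibbs kernel targeting $\Pi_{\Lambda,y}$ that updates $m$ components at a time). *)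

theory Defs
  imports "HOL-Probability.Probability"
begin

definition polish_topology :: "'a topology \<Rightarrow> bool" where
  "polish_topology X \<longleftrightarrow> completely_metrizable_space X \<and> separable_space X"

definition borel_of :: "'a topology \<Rightarrow> 'a measure" where
  "borel_of X = sigma (topspace X) {U. openin X U}"

text \<open>A point of the product over an index set \<open>\<Lambda>\<close> is an extensional function on \<open>\<Lambda>\<close>; the
  product carries the product of the Borel sigma-algebras, which for countably many Polish factors
  is the Borel sigma-algebra of the product topology.\<close>

definition prod_space :: "(nat \<Rightarrow> 'a topology) \<Rightarrow> nat set \<Rightarrow> (nat \<Rightarrow> 'a) measure" where
  "prod_space X \<Lambda> = (\<Pi>\<^sub>M i\<in>\<Lambda>. borel_of (X i))"


section \<open>Mean-zero square-integrable functions\<close>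

text \<open>Elements of \<open>L02 \<omega>\<close> are functions rather than classes modulo a.e. equality, so the zero class
  consists of the functions that vanish a.e.\<close>

definition L02 :: "'x measure \<Rightarrow> ('x \<Rightarrow> real) set" where
  "L02 \<omega> = {f \<in> borel_measurable \<omega>. integrable \<omega> (\<lambda>x. (f x)\<^sup>2) \<and> (\<integral>x. f x \<partial>\<omega>) = 0}"

definition L2_inner :: "'x measure \<Rightarrow> ('x \<Rightarrow> real) \<Rightarrow> ('x \<Rightarrow> real) \<Rightarrow> real" where
  "L2_inner \<omega> f g = (\<integral>x. f x * g x \<partial>\<omega>)"

definition L2_norm :: "'x measure \<Rightarrow> ('x \<Rightarrow> real) \<Rightarrow> real" where
  "L2_norm \<omega> f = sqrt (L2_inner \<omega> f f)"

definition kernel_op :: "('x \<Rightarrow> 'x measure) \<Rightarrow> ('x \<Rightarrow> real) \<Rightarrow> 'x \<Rightarrow> real" where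
  "kernel_op K f x = (\<integral>x'. f x' \<partial>K x)"

text \<open>The supremum is over the closed unit ball, so the value is \<open>0\<close> when \<open>L02 \<omega>\<close> is trivial.
  The set is bounded above by \<open>1\<close> when \<open>\<omega>\<close> is \<open>K\<close>-invariant.\<close>

definition kernel_norm :: "'x measure \<Rightarrow> ('x \<Rightarrow> 'x measure) \<Rightarrow> real" where
  "kernel_norm \<omega> K = (SUP f\<in>{f \<in> L02 \<omega>. L2_norm \<omega> f \<le> 1}. L2_norm \<omega> (kernel_op K f))"

definition dirichlet_form :: "'x measure \<Rightarrow> ('x \<Rightarrow> 'x measure) \<Rightarrow> ('x \<Rightarrow> real) \<Rightarrow> real" where
  "dirichlet_form \<omega> K f = (L2_norm \<omega> f)\<^sup>2 - L2_inner \<omega> f (kernel_op K f)"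


section \<open>Asymptotic variance of a stationary chain\<close>

text \<open>The law of the whole trajectory \<open>(X(s))\<close>, \<open>s \<ge> 0\<close>, of the chain with kernel \<open>K\<close> and
  \<open>X(0) \<sim> \<omega>\<close>, obtained from the Ionescu-Tulcea construction: \<open>chain_step \<omega> K s h\<close> is the conditional
  law of \<open>X(s)\<close> given the history \<open>h\<close> before time \<open>s\<close>.\<close>

definition chain_step ::
    "'x measure \<Rightarrow> ('x \<Rightarrow> 'x measure) \<Rightarrow> nat \<Rightarrow> (nat \<Rightarrow> 'x) \<Rightarrow> 'x measure" where
  "chain_step \<omega> K s h = (case s of 0 \<Rightarrow> \<omega> | Suc t \<Rightarrow> K (h t))"

definition chain_law :: "'x measure \<Rightarrow> ('x \<Rightarrow> 'x measure) \<Rightarrow> (nat \<Rightarrow> 'x) measure" where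
  "chain_law \<omega> K =
     projective_family.lim UNIV (Ionescu_Tulcea.CI (chain_step \<omega> K) (\<lambda>_. \<omega>)) (\<lambda>_. \<omega>)"

definition asymp_var :: "'x measure \<Rightarrow> ('x \<Rightarrow> 'x measure) \<Rightarrow> ('x \<Rightarrow> real) \<Rightarrow> real" where
  "asymp_var \<omega> K f =
     lim (\<lambda>t. prob_space.variance (chain_law \<omega> K) (\<lambda>\<xi>. \<Sum>s=1..t. f (\<xi> s)) / real t)"


section \<open>Conditional distributions and random-scan Gibbs kernels\<close>

definition marginal ::
    "(nat \<Rightarrow> 'a topology) \<Rightarrow> (nat \<Rightarrow> 'a) measure \<Rightarrow> nat set \<Rightarrow> (nat \<Rightarrow> 'a) measure" where
  "marginal X P \<Gamma> = distr P (prod_space X \<Gamma>) (\<lambda>x. restrict x \<Gamma>)"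

text \<open>\<open>\<kappa>\<close> is a (regular) version of the conditional distribution of the coordinates in \<open>\<Lambda>\<close> given the
  remaining ones, under the measure \<open>P\<close> on the product over \<open>{1..n}\<close>.\<close>

definition is_cond_distr ::
    "nat \<Rightarrow> (nat \<Rightarrow> 'a topology) \<Rightarrow> (nat \<Rightarrow> 'a) measure \<Rightarrow> nat set
      \<Rightarrow> ((nat \<Rightarrow> 'a) \<Rightarrow> (nat \<Rightarrow> 'a) measure) \<Rightarrow> bool" where
  "is_cond_distr n X P \<Lambda> \<kappa> \<longleftrightarrow>
     \<kappa> \<in> prod_space X ({1..n} - \<Lambda>) \<rightarrow>\<^sub>M prob_algebra (prod_space X \<Lambda>) \<and>
     (\<forall>A\<in>sets (prod_space X \<Lambda>). \<forall>B\<in>sets (prod_space X ({1..n} - \<Lambda>)).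
        emeasure P {x \<in> space P. restrict x \<Lambda> \<in> A \<and> restrict x ({1..n} - \<Lambda>) \<in> B} =
        (\<integral>\<^sup>+y\<in>B. emeasure (\<kappa> y) A \<partial>marginal X P ({1..n} - \<Lambda>)))"

text \<open>In the kernels below \<open>\<kappa> \<Lambda> y\<close> stands for the conditional distribution of the coordinates in
  \<open>\<Lambda>\<close> given that the others equal \<open>y\<close>.\<close>

definition gibbs_kernel ::
    "nat \<Rightarrow> (nat \<Rightarrow> 'a topology) \<Rightarrow> (nat set \<Rightarrow> (nat \<Rightarrow> 'a) \<Rightarrow> (nat \<Rightarrow> 'a) measure) \<Rightarrow> nat
      \<Rightarrow> (nat \<Rightarrow> 'a) \<Rightarrow> (nat \<Rightarrow> 'a) measure" where
  "gibbs_kernel n X \<kappa> r x =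
     measure_of (space (prod_space X {1..n})) (sets (prod_space X {1..n}))
       (\<lambda>A. (\<Sum>\<Lambda> | \<Lambda> \<subseteq> {1..n} \<and> card \<Lambda> = r.
               emeasure (distr (\<kappa> \<Lambda> (restrict x ({1..n} - \<Lambda>))) (prod_space X {1..n})
                           (\<lambda>z. merge \<Lambda> ({1..n} - \<Lambda>) (z, x))) A)
            / of_nat (n choose r))"

text \<open>Here \<open>u\<close> is the current state on \<open>\<Lambda>\<close> and \<open>y\<close> the frozen state off \<open>\<Lambda>\<close>; together they form
  the point \<open>merge \<Lambda> ({1..n} - \<Lambda>) (u, y)\<close> of the full product.\<close>

definition cond_gibbs_kernel ::
    "nat \<Rightarrow> (nat \<Rightarrow> 'a topology) \<Rightarrow> (nat set \<Rightarrow> (nat \<Rightarrow> 'a) \<Rightarrow> (nat \<Rightarrow> 'a) measure) \<Rightarrow> nat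
      \<Rightarrow> nat set \<Rightarrow> (nat \<Rightarrow> 'a) \<Rightarrow> (nat \<Rightarrow> 'a) \<Rightarrow> (nat \<Rightarrow> 'a) measure" where
  "cond_gibbs_kernel n X \<kappa> m \<Lambda> y u =
     measure_of (space (prod_space X \<Lambda>)) (sets (prod_space X \<Lambda>))
       (\<lambda>A. (\<Sum>\<Gamma> | \<Gamma> \<subseteq> \<Lambda> \<and> card \<Gamma> = m.
               emeasure (distr (\<kappa> \<Gamma> (restrict (merge \<Lambda> ({1..n} - \<Lambda>) (u, y)) ({1..n} - \<Gamma>)))
                           (prod_space X \<Lambda>) (\<lambda>z. merge \<Gamma> (\<Lambda> - \<Gamma>) (z, u))) A)
            / of_nat (card \<Lambda> choose m))"

end

theory Submission
  imports Defs
begin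

text \<open>Write \<open>E\<^sub>\<Lambda>\<close> for the operator that resamples the block \<open>\<Lambda>\<close>. It is a conditional expectation,
  so it is a self-adjoint projection and \<open>E\<^sub>\<Lambda> E\<^sub>\<Gamma> = E\<^sub>\<Lambda>\<close> for \<open>\<Gamma> \<subseteq> \<Lambda>\<close>; hence
  \<open>\<langle>f, E\<^sub>\<Lambda> f\<rangle> \<le> \<langle>f, E\<^sub>\<Gamma> f\<rangle>\<close>, and averaging gives \<open>\<E>\<^sub>m(f) \<le> \<E>\<^sub>l(f)\<close> for the Dirichlet forms of
  \<open>T\<^sub>m\<close> and \<open>T\<^sub>l\<close>. Integrating the gap inequality for \<open>Q\<^sub>\<Lambda>\<^sub>,\<^sub>y\<close>, applied to the centred restriction of
  \<open>f\<close> to the fibre over \<open>y\<close>, and averaging over \<open>\<Lambda>\<close> gives \<open>c\<^sub>1 \<E>\<^sub>l(f) \<le> \<E>\<^sub>m(f)\<close>.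

  Both kernels are positive operators, so their norms are suprema of their quadratic forms and the
  first claim follows. For the second, the asymptotic variance is \<open>2 \<langle>f, (I - T)\<inverse> f\<rangle> - \<parallel>f\<parallel>\<^sup>2\<close>, and
  \<open>\<langle>f, (I - T)\<inverse> f\<rangle> = sup\<^sub>g (2 \<langle>f, g\<rangle> - \<E>\<^sub>T(g))\<close> is antitone in the Dirichlet form.\<close>

section \<open>Integration against kernels\<close>

text \<open>Members of \<open>L02\<close> are functions and \<open>kernel_op\<close> is a pointwise
  integral, which is 0 by convention where it diverges. A square-integrable function need not be
  integrable under every single kernel, so linearity of the operators is available only almost
  everywhere; it is recovered in inner products, and the null sets have to be carried from the
  product to the fibres and back. The quadratic form takes over the role of spectral theory:
  Cauchy-Schwarz for the form <f, K g> bounds the operator norm, and (I - T)^-1 is present only as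
  the series of the numbers <f, T^k f>, which a norm below 1 makes geometric. A norm of T_m below 1
  is not assumed; it comes out of the first claim once c_1 > 0. The factor 1/c_1 comes from testing
  the variational formula of T_l at c_1 g.\<close>

lemma
  fixes f :: "'b \<Rightarrow> real"
  assumes N[measurable]: "N \<in> M \<rightarrow>\<^sub>M subprob_algebra B" and ne: "space M \<noteq> {}"
    and int: "integrable (M \<bind> N) f"
  shows AE_integrable_kernel: "AE x in M. integrable (N x) f"
    and integrable_kernel: "integrable M (\<lambda>x. \<integral>y. f y \<partial>N x)"
    and integral_bind_kernel: "(\<integral>y. f y \<partial>(M \<bind> N)) = (\<integral>x. \<integral>y. f y \<partial>N x \<partial>M)"
proof -
  have sB: "sets (M \<bind> N) = sets B"
    by (intro sets_bind subprob_measurableD(2)[OF N] ne)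
  have fB[measurable]: "f \<in> borel_measurable B"
    using borel_measurable_integrable[OF int] sB by (simp cong: measurable_cong_sets)
  have fN: "f \<in> borel_measurable (N x)" if "x \<in> space M" for x
    using fB subprob_measurableD(2)[OF N that] by (simp cong: measurable_cong_sets)
  note bind = nn_integral_bind[OF _ N]
  have norm: "(\<integral>\<^sup>+x. \<integral>\<^sup>+y. norm (f y) \<partial>N x \<partial>M) < \<infinity>"
    using int by (subst bind[symmetric]) (auto simp: integrable_iff_bounded)
  have "AE x in M. (\<integral>\<^sup>+y. norm (f y) \<partial>N x) \<noteq> \<infinity>"
    using norm by (intro nn_integral_PInf_AE) auto
  then show AE: "AE x in M. integrable (N x) f"
    using AE_space
    by eventually_elim (use fN in \<open>auto simp: integrable_iff_bounded top.not_eq_extremum\<close>)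
  \<comment> \<open>Used for f and for -f: \<open>ennreal\<close> sends negative values to 0, so the
    two instances are the positive and the negative part. Both are dominated by the norm of f, whose
    iterated integral is finite, so \<open>enn2real\<close> loses nothing off a null set.\<close>
  have part: "integrable M (\<lambda>x. enn2real (\<integral>\<^sup>+y. ennreal (g y) \<partial>N x)) \<and>
      (\<integral>x. enn2real (\<integral>\<^sup>+y. ennreal (g y) \<partial>N x) \<partial>M) = enn2real (\<integral>\<^sup>+y. ennreal (g y) \<partial>(M \<bind> N))"
    if [measurable]: "g \<in> borel_measurable B" and le: "\<And>y. g y \<le> norm (f y)" for g
  proof -
    have le': "(\<integral>\<^sup>+x. \<integral>\<^sup>+y. g y \<partial>N x \<partial>M) < \<infinity>"
      by (rule le_less_trans[OF _ norm]) (intro nn_integral_mono ennreal_leI le)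
    then have "AE x in M. (\<integral>\<^sup>+y. g y \<partial>N x) \<noteq> \<infinity>"
      by (intro nn_integral_PInf_AE) auto
    then have "AE x in M. ennreal (enn2real (\<integral>\<^sup>+y. g y \<partial>N x)) = (\<integral>\<^sup>+y. g y \<partial>N x)"
      by eventually_elim (simp add: ennreal_enn2real_if)
    then have eq: "(\<integral>\<^sup>+x. ennreal (enn2real (\<integral>\<^sup>+y. g y \<partial>N x)) \<partial>M) = (\<integral>\<^sup>+x. \<integral>\<^sup>+y. g y \<partial>N x \<partial>M)"
      by (rule nn_integral_cong_AE)
    then show ?thesis
      using le' eq by (simp add: integrable_iff_bounded integral_eq_nn_integral bind)
  qed
  have split: "AE x in M. (\<integral>y. f y \<partial>N x) =
      enn2real (\<integral>\<^sup>+y. ennreal (f y) \<partial>N x) - enn2real (\<integral>\<^sup>+y. ennreal (- f y) \<partial>N x)"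
    using AE by eventually_elim (simp add: real_lebesgue_integral_def)
  note p = part[of f] part[of "\<lambda>y. - f y"]
  have meas: "(\<lambda>x. \<integral>y. f y \<partial>N x) \<in> borel_measurable M"
    by (rule measurable_compose[OF N]) measurable
  show "integrable M (\<lambda>x. \<integral>y. f y \<partial>N x)"
    using p by (subst integrable_cong_AE[OF meas _ split]) auto
  show "(\<integral>y. f y \<partial>(M \<bind> N)) = (\<integral>x. \<integral>y. f y \<partial>N x \<partial>M)"
    using p by (subst integral_cong_AE[OF meas _ split]) (auto simp: real_lebesgue_integral_def[OF int])
qed


section \<open>The semi-inner product on mean-zero functions\<close>

lemma square_integrable_mult:
  fixes f g :: "'x \<Rightarrow> real"
  assumes [measurable]: "f \<in> borel_measurable M" "g \<in> borel_measurable M"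
    and f: "integrable M (\<lambda>x. (f x)\<^sup>2)" and g: "integrable M (\<lambda>x. (g x)\<^sup>2)"
  shows "integrable M (\<lambda>x. f x * g x)"
proof (rule Bochner_Integration.integrable_bound[OF Bochner_Integration.integrable_add[OF f g]])
  have "\<bar>a * b\<bar> \<le> a\<^sup>2 + b\<^sup>2" for a b :: real
    using sum_squares_bound[of a b] sum_squares_bound[of a "- b"] by (simp add: abs_if)
  then show "AE x in M. norm (f x * g x) \<le> norm ((f x)\<^sup>2 + (g x)\<^sup>2)"
    by simp
qed measurable

text \<open>The discriminant argument is kept to bare numbers because it serves two forms, <f, g>
  and <f, K g>. The test points (-B, A) and (C, -B) give A and C times the difference A C - B^2; in
  the degenerate case A = C = 0 the points (1, 1) and (1, -1) force B = 0.\<close>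

lemma nonneg_form_Cauchy_Schwarz:
  fixes A B C :: real
  assumes "\<And>s t. 0 \<le> s\<^sup>2 * A + 2 * s * t * B + t\<^sup>2 * C"
  shows "B\<^sup>2 \<le> A * C"
proof -
  have A: "0 \<le> A" and C: "0 \<le> C" and p: "0 \<le> A + 2 * B + C" and m: "0 \<le> A - 2 * B + C"
    using assms[of 1 0] assms[of 0 1] assms[of 1 1] assms[of 1 "-1"] by auto
  have 1: "0 \<le> A * (A * C - B\<^sup>2)" and 2: "0 \<le> C * (A * C - B\<^sup>2)"
    using assms[of "-B" A] assms[of C "-B"] by (auto simp: algebra_simps power2_eq_square)
  show ?thesis
  proof (cases "A = 0 \<and> C = 0")
    case True
    with p m show ?thesis by auto
  next
    case False
    with A C 1 2 show ?thesis by (auto simp: zero_le_mult_iff)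
  qed
qed

context prob_space
begin

lemma square_integrable_integrable:
  fixes f :: "'a \<Rightarrow> real"
  assumes "f \<in> borel_measurable M" "integrable M (\<lambda>x. (f x)\<^sup>2)"
  shows "integrable M f"
  using square_integrable_mult[of f M "\<lambda>_. 1"] assms by simp

lemma L02_measurable: "f \<in> L02 M \<Longrightarrow> f \<in> borel_measurable M"
  and L02_square: "f \<in> L02 M \<Longrightarrow> integrable M (\<lambda>x. (f x)\<^sup>2)"
  and L02_mean: "f \<in> L02 M \<Longrightarrow> (\<integral>x. f x \<partial>M) = 0"
  by (auto simp: L02_def)

lemma L02_integrable: "f \<in> L02 M \<Longrightarrow> integrable M f"
  by (auto simp: L02_def intro: square_integrable_integrable)

lemma L02_mult: "f \<in> L02 M \<Longrightarrow> g \<in> L02 M \<Longrightarrow> integrable M (\<lambda>x. f x * g x)"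
  by (auto simp: L02_def intro: square_integrable_mult)

lemma L02_lincomb:
  assumes "f \<in> L02 M" "g \<in> L02 M"
  shows "(\<lambda>x. a * f x + b * g x) \<in> L02 M"
proof -
  note [simp] = L02_integrable[OF assms(1)] L02_integrable[OF assms(2)]
    L02_square[OF assms(1)] L02_square[OF assms(2)] L02_mult[OF assms]
  have "(\<lambda>x. (a * f x + b * g x)\<^sup>2) = (\<lambda>x. a\<^sup>2 * (f x)\<^sup>2 + 2 * a * b * (f x * g x) + b\<^sup>2 * (g x)\<^sup>2)"
    by (auto simp: power2_eq_square algebra_simps)
  then have "integrable M (\<lambda>x. (a * f x + b * g x)\<^sup>2)" by simp
  then show ?thesis
    using assms[THEN L02_measurable] assms[THEN L02_mean] by (simp add: L02_def)
qed

lemma L02_zero: "(\<lambda>_. 0) \<in> L02 M"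
  by (simp add: L02_def)

lemma L02_scale: "f \<in> L02 M \<Longrightarrow> (\<lambda>x. a * f x) \<in> L02 M"
  and L02_add: "f \<in> L02 M \<Longrightarrow> g \<in> L02 M \<Longrightarrow> (\<lambda>x. f x + g x) \<in> L02 M"
  and L02_diff: "f \<in> L02 M \<Longrightarrow> g \<in> L02 M \<Longrightarrow> (\<lambda>x. f x - g x) \<in> L02 M"
  using L02_lincomb[of f f a 0] L02_lincomb[of f g 1 1] L02_lincomb[of f g 1 "-1"] by auto

lemma L02_sum: "finite I \<Longrightarrow> (\<And>i. i \<in> I \<Longrightarrow> f i \<in> L02 M) \<Longrightarrow> (\<lambda>x. \<Sum>i\<in>I. f i x) \<in> L02 M"
  by (induction I rule: finite_induct) (auto intro: L02_zero L02_add)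

lemma L2_inner_commute: "L2_inner M f g = L2_inner M g f"
  by (simp add: L2_inner_def mult.commute)

lemma L2_inner_cong_AE:
  assumes [measurable]: "f \<in> borel_measurable M" "f' \<in> borel_measurable M" "g \<in> borel_measurable M"
    and eq: "AE x in M. f x = f' x"
  shows "L2_inner M f g = L2_inner M f' g"
  unfolding L2_inner_def by (intro integral_cong_AE) (measurable, use eq in auto)

lemma L2_inner_nonneg: "0 \<le> L2_inner M f f"
  by (simp add: L2_inner_def)

lemma L2_norm_square: "(L2_norm M f)\<^sup>2 = L2_inner M f f"
  by (simp add: L2_norm_def L2_inner_nonneg)

lemma L2_norm_nonneg: "0 \<le> L2_norm M f"
  by (simp add: L2_norm_def L2_inner_nonneg)

lemma L2_inner_lincomb_left:
  assumes "f \<in> L02 M" "g \<in> L02 M" "h \<in> L02 M"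
  shows "L2_inner M (\<lambda>x. a * f x + b * g x) h = a * L2_inner M f h + b * L2_inner M g h"
proof -
  have "(\<lambda>x. (a * f x + b * g x) * h x) = (\<lambda>x. a * (f x * h x) + b * (g x * h x))"
    by (auto simp: algebra_simps)
  then show ?thesis
    using L02_mult[OF assms(1,3)] L02_mult[OF assms(2,3)] by (simp add: L2_inner_def)
qed

lemma L2_inner_scale: "L2_inner M (\<lambda>x. a * f x) h = a * L2_inner M f h"
  by (simp add: L2_inner_def mult.assoc)

lemma L2_inner_add: "\<lbrakk>f \<in> L02 M; g \<in> L02 M; h \<in> L02 M\<rbrakk> \<Longrightarrow>
    L2_inner M (\<lambda>x. f x + g x) h = L2_inner M f h + L2_inner M g h"
  and L2_inner_diff: "\<lbrakk>f \<in> L02 M; g \<in> L02 M; h \<in> L02 M\<rbrakk> \<Longrightarrow>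
    L2_inner M (\<lambda>x. f x - g x) h = L2_inner M f h - L2_inner M g h"
  using L2_inner_lincomb_left[of f g h 1 1] L2_inner_lincomb_left[of f g h 1 "-1"] by auto

lemma L2_inner_add_right: "\<lbrakk>f \<in> L02 M; g \<in> L02 M; h \<in> L02 M\<rbrakk> \<Longrightarrow>
    L2_inner M h (\<lambda>x. f x + g x) = L2_inner M h f + L2_inner M h g"
  and L2_inner_diff_right: "\<lbrakk>f \<in> L02 M; g \<in> L02 M; h \<in> L02 M\<rbrakk> \<Longrightarrow>
    L2_inner M h (\<lambda>x. f x - g x) = L2_inner M h f - L2_inner M h g"
  and L2_inner_scale_right: "L2_inner M h (\<lambda>x. a * f x) = a * L2_inner M h f"
  by (simp_all add: L2_inner_commute[of h] L2_inner_add L2_inner_diff L2_inner_scale)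

lemma L2_inner_sum: "finite I \<Longrightarrow> (\<And>i. i \<in> I \<Longrightarrow> f i \<in> L02 M) \<Longrightarrow> h \<in> L02 M \<Longrightarrow>
    L2_inner M (\<lambda>x. \<Sum>i\<in>I. f i x) h = (\<Sum>i\<in>I. L2_inner M (f i) h)"
proof (induction I rule: finite_induct)
  case empty
  show ?case by (simp add: L2_inner_def)
qed (simp add: L2_inner_add L02_sum)

lemma L2_Cauchy_Schwarz:
  assumes "f \<in> L02 M" "g \<in> L02 M"
  shows "(L2_inner M f g)\<^sup>2 \<le> L2_inner M f f * L2_inner M g g"
proof (rule nonneg_form_Cauchy_Schwarz)
  fix s t
  let ?h = "\<lambda>x. s * f x + t * g x"
  have "0 \<le> L2_inner M ?h ?h" by (rule L2_inner_nonneg)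
  also have "\<dots> = s\<^sup>2 * L2_inner M f f + 2 * s * t * L2_inner M f g + t\<^sup>2 * L2_inner M g g"
    using assms by (simp add: L2_inner_lincomb_left L02_lincomb L02_scale L2_inner_add_right
      L2_inner_scale_right L2_inner_commute[of g f] power2_eq_square algebra_simps)
  finally show "0 \<le> s\<^sup>2 * L2_inner M f f + 2 * s * t * L2_inner M f g + t\<^sup>2 * L2_inner M g g" .
qed

lemma L2_Cauchy_Schwarz_norm:
  assumes "f \<in> L02 M" "g \<in> L02 M"
  shows "\<bar>L2_inner M f g\<bar> \<le> L2_norm M f * L2_norm M g"
  using real_sqrt_le_mono[OF L2_Cauchy_Schwarz[OF assms]] by (simp add: L2_norm_def real_sqrt_mult)

end


section \<open>Kernels with an invariant law\<close>

locale invariant_kernel = prob_space M for M :: "'x measure" +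
  fixes K :: "'x \<Rightarrow> 'x measure"
  assumes K_prob[measurable]: "K \<in> M \<rightarrow>\<^sub>M prob_algebra M"
    and invariant: "M \<bind> K = M"
begin

lemma K_subprob[measurable]: "K \<in> M \<rightarrow>\<^sub>M subprob_algebra M"
  using K_prob by (rule measurable_prob_algebraD)

lemma K_sets: "x \<in> space M \<Longrightarrow> sets (K x) = sets M"
  using subprob_measurableD[OF K_subprob] by auto

lemma K_prob_space: "x \<in> space M \<Longrightarrow> prob_space (K x)"
  using measurable_space[OF K_prob] by (auto simp: space_prob_algebra)

lemma K_measurable: "x \<in> space M \<Longrightarrow> f \<in> borel_measurable M \<Longrightarrow> f \<in> borel_measurable (K x)"
  using K_sets[of x] by (simp cong: measurable_cong_sets)

lemma
  fixes f :: "'x \<Rightarrow> real"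
  assumes "integrable M f"
  shows AE_integrable_K: "AE x in M. integrable (K x) f"
    and integrable_op: "integrable M (kernel_op K f)"
    and integral_op: "(\<integral>x. kernel_op K f x \<partial>M) = (\<integral>x. f x \<partial>M)"
  using AE_integrable_kernel[OF K_subprob not_empty] integrable_kernel[OF K_subprob not_empty]
    integral_bind_kernel[OF K_subprob not_empty] assms
  by (simp_all add: kernel_op_def[abs_def] invariant)

lemma AE_AE_K:
  assumes "Measurable.pred M Q" "AE x in M. Q x"
  shows "AE x in M. AE y in K x. Q y"
  using AE_bind[OF K_subprob assms(1)] assms(2) unfolding invariant by (rule iffD1)

lemma measurable_op[measurable (raw)]:
  "f \<in> borel_measurable M \<Longrightarrow> kernel_op K f \<in> borel_measurable M"
  unfolding kernel_op_def[abs_def] by (rule measurable_compose[OF K_subprob]) measurable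

text \<open>Jensen on each \<open>K x\<close>: the variance of f under \<open>K x\<close> is
  nonnegative, so (K f)^2 is at most K (f^2) almost everywhere, and invariance turns the integral of
  the latter into that of f^2.\<close>

lemma
  assumes f: "f \<in> borel_measurable M" "integrable M (\<lambda>x. (f x)\<^sup>2)"
  shows square_integrable_op: "integrable M (\<lambda>x. (kernel_op K f x)\<^sup>2)"
    and integral_square_op: "(\<integral>x. (kernel_op K f x)\<^sup>2 \<partial>M) \<le> (\<integral>x. (f x)\<^sup>2 \<partial>M)"
proof -
  have "AE x in M. integrable (K x) (\<lambda>y. (f y)\<^sup>2)"
    using f(2) by (rule AE_integrable_K)
  then have le: "AE x in M. (kernel_op K f x)\<^sup>2 \<le> kernel_op K (\<lambda>y. (f y)\<^sup>2) x"
    using AE_space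
  proof eventually_elim
    case (elim x)
    interpret Kx: prob_space "K x" by (rule K_prob_space) (rule elim)
    have *: "integrable (K x) f"
      by (rule Kx.square_integrable_integrable[OF K_measurable[OF elim(2) f(1)] elim(1)])
    have "0 \<le> Kx.variance f" by simp
    also have "\<dots> = (\<integral>y. (f y)\<^sup>2 \<partial>K x) - (\<integral>y. f y \<partial>K x)\<^sup>2"
      using Kx.variance_eq[OF * elim(1)] .
    finally show "(kernel_op K f x)\<^sup>2 \<le> kernel_op K (\<lambda>y. (f y)\<^sup>2) x"
      by (simp add: kernel_op_def)
  qed
  note int = integrable_op[OF f(2)]
  have nonneg: "0 \<le> kernel_op K (\<lambda>y. (f y)\<^sup>2) x" for x
    by (simp add: kernel_op_def)
  show *: "integrable M (\<lambda>x. (kernel_op K f x)\<^sup>2)"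
    using le by (intro Bochner_Integration.integrable_bound[OF int])
      (use f in \<open>auto simp: nonneg\<close>)
  show "(\<integral>x. (kernel_op K f x)\<^sup>2 \<partial>M) \<le> (\<integral>x. (f x)\<^sup>2 \<partial>M)"
    using integral_mono_AE[OF * int le] integral_op[OF f(2)] by simp
qed

lemma op_L02: "f \<in> L02 M \<Longrightarrow> kernel_op K f \<in> L02 M"
  by (simp add: L02_def square_integrable_op integral_op square_integrable_integrable measurable_op)

lemma op_contraction: "f \<in> L02 M \<Longrightarrow> L2_norm M (kernel_op K f) \<le> L2_norm M f"
  using integral_square_op[OF L02_measurable L02_square, of f]
  by (simp add: L2_norm_def L2_inner_def flip: power2_eq_square)

lemma op_scale: "kernel_op K (\<lambda>x. a * f x) = (\<lambda>x. a * kernel_op K f x)"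
  by (auto simp: kernel_op_def)

lemma op_iter_L02: "f \<in> L02 M \<Longrightarrow> (kernel_op K ^^ k) f \<in> L02 M"
  by (induction k) (auto intro: op_L02)

lemma kernel_norm_bdd: "bdd_above ((\<lambda>f. L2_norm M (kernel_op K f)) ` {f \<in> L02 M. L2_norm M f \<le> 1})"
  by (rule bdd_aboveI[of _ 1]) (auto dest: op_contraction)

lemma kernel_norm_nonneg: "0 \<le> kernel_norm M K"
proof -
  have "L2_norm M (kernel_op K (\<lambda>_. 0)) \<le> kernel_norm M K"
    unfolding kernel_norm_def
    by (rule cSUP_upper[OF _ kernel_norm_bdd]) (simp add: L02_zero L2_norm_def L2_inner_def)
  then show ?thesis using L2_norm_nonneg order_trans by blast
qed

lemma kernel_norm_le:
  assumes "\<And>f. f \<in> L02 M \<Longrightarrow> L2_norm M f \<le> 1 \<Longrightarrow> L2_norm M (kernel_op K f) \<le> q"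
  shows "kernel_norm M K \<le> q"
  unfolding kernel_norm_def
proof (rule cSUP_least)
  have "(\<lambda>_. 0) \<in> {f \<in> L02 M. L2_norm M f \<le> 1}"
    by (simp add: L02_zero L2_norm_def L2_inner_def)
  then show "{f \<in> L02 M. L2_norm M f \<le> 1} \<noteq> {}" by blast
qed (use assms in auto)

lemma op_norm_le:
  assumes f: "f \<in> L02 M"
  shows "L2_norm M (kernel_op K f) \<le> kernel_norm M K * L2_norm M f"
\<comment> \<open>A function of norm 0 cannot be rescaled to the unit sphere, but then contraction
  already forces the left side to 0.\<close>
proof (cases "L2_norm M f = 0")
  case True
  then show ?thesis using op_contraction[OF f] by simp
next
  case False
  define r where "r = L2_norm M f"
  have r: "0 < r" using False L2_norm_nonneg[of f] by (simp add: r_def)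
  have nrm: "L2_norm M (\<lambda>x. inverse r * h x) = inverse r * L2_norm M h" for h
    using r by (simp only: L2_norm_def L2_inner_scale L2_inner_scale_right)
      (simp add: real_sqrt_mult flip: mult.assoc)
  have "L2_norm M (kernel_op K (\<lambda>x. inverse r * f x)) \<le> kernel_norm M K"
    unfolding kernel_norm_def
  proof (rule cSUP_upper[OF _ kernel_norm_bdd])
    have "L2_norm M (\<lambda>x. inverse r * f x) = 1"
      using r by (subst nrm) (simp add: r_def)
    then show "(\<lambda>x. inverse r * f x) \<in> {f \<in> L02 M. L2_norm M f \<le> 1}"
      by (simp add: L02_scale f)
  qed
  then have "inverse r * L2_norm M (kernel_op K f) \<le> kernel_norm M K"
    by (simp only: op_scale nrm)
  then show ?thesis
    using r by (simp add: r_def[symmetric] field_simps)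
qed

lemma op_iter_norm_le:
  assumes f: "f \<in> L02 M"
  shows "L2_norm M ((kernel_op K ^^ k) f) \<le> kernel_norm M K ^ k * L2_norm M f"
proof (induction k)
  case (Suc k)
  have "L2_norm M (kernel_op K ((kernel_op K ^^ k) f)) \<le> kernel_norm M K * L2_norm M ((kernel_op K ^^ k) f)"
    by (intro op_norm_le op_iter_L02 f)
  also have "\<dots> \<le> kernel_norm M K * (kernel_norm M K ^ k * L2_norm M f)"
    by (intro mult_left_mono Suc kernel_norm_nonneg)
  finally show ?case by (simp add: mult.assoc)
qed simp

lemma inner_iter_bound:
  assumes "f \<in> L02 M" "g \<in> L02 M"
  shows "\<bar>L2_inner M g ((kernel_op K ^^ k) f)\<bar> \<le> L2_norm M g * L2_norm M f * kernel_norm M K ^ k"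
proof -
  have "\<bar>L2_inner M g ((kernel_op K ^^ k) f)\<bar> \<le> L2_norm M g * L2_norm M ((kernel_op K ^^ k) f)"
    using assms by (intro L2_Cauchy_Schwarz_norm op_iter_L02)
  also have "\<dots> \<le> L2_norm M g * (kernel_norm M K ^ k * L2_norm M f)"
    using assms by (intro mult_left_mono op_iter_norm_le L2_norm_nonneg)
  finally show ?thesis by (simp add: mult_ac)
qed

end


section \<open>Positive reversible kernels\<close>

text \<open>Reversibility enters as symmetry of the operator. Positivity, which averages of
  projections have, is what lets the norm be read off the form without absolute values.\<close>

locale positive_kernel = invariant_kernel +
  assumes self_adjoint: "f \<in> L02 M \<Longrightarrow> g \<in> L02 M \<Longrightarrow>
      L2_inner M (kernel_op K f) g = L2_inner M f (kernel_op K g)"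
    and positive: "f \<in> L02 M \<Longrightarrow> 0 \<le> L2_inner M f (kernel_op K f)"
begin

text \<open>Pointwise linearity of \<open>kernel_op\<close> can fail where an integral diverges.
  Moving the operator onto h by self-adjointness gives linearity in the weak form with no null set
  to track.\<close>

lemma op_inner_lincomb:
  assumes "f \<in> L02 M" "g \<in> L02 M" "h \<in> L02 M"
  shows "L2_inner M (kernel_op K (\<lambda>x. a * f x + b * g x)) h =
    a * L2_inner M (kernel_op K f) h + b * L2_inner M (kernel_op K g) h"
  using assms by (simp add: self_adjoint L02_lincomb L2_inner_lincomb_left op_L02)

lemma op_Cauchy_Schwarz:
  assumes "f \<in> L02 M" "g \<in> L02 M"
  shows "(L2_inner M f (kernel_op K g))\<^sup>2 \<le> L2_inner M f (kernel_op K f) * L2_inner M g (kernel_op K g)"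
proof (rule nonneg_form_Cauchy_Schwarz)
  fix s t
  let ?h = "\<lambda>x. s * f x + t * g x"
  have *: "L2_inner M g (kernel_op K f) = L2_inner M f (kernel_op K g)"
    using self_adjoint[OF assms] by (simp add: L2_inner_commute[of g])
  have "0 \<le> L2_inner M ?h (kernel_op K ?h)"
    by (rule positive) (simp add: L02_lincomb assms)
  also have "\<dots> = L2_inner M (kernel_op K ?h) ?h" by (rule L2_inner_commute)
  also have "\<dots> = s * L2_inner M ?h (kernel_op K f) + t * L2_inner M ?h (kernel_op K g)"
    using op_inner_lincomb[OF assms L02_lincomb[OF assms], of s t s t]
    by (simp only: L2_inner_commute[of ?h])
  also have "\<dots> = s\<^sup>2 * L2_inner M f (kernel_op K f) + 2 * s * t * L2_inner M f (kernel_op K g)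
      + t\<^sup>2 * L2_inner M g (kernel_op K g)"
    using assms * by (simp add: L2_inner_lincomb_left op_L02 power2_eq_square algebra_simps)
  finally show "0 \<le> s\<^sup>2 * L2_inner M f (kernel_op K f) + 2 * s * t * L2_inner M f (kernel_op K g)
      + t\<^sup>2 * L2_inner M g (kernel_op K g)" .
qed

lemma form_le_kernel_norm:
  assumes "f \<in> L02 M"
  shows "L2_inner M f (kernel_op K f) \<le> kernel_norm M K * L2_inner M f f"
  using inner_iter_bound[of f f 1] assms by (simp add: L2_norm_square[symmetric] power2_eq_square mult_ac)

text \<open>With g = K f, Cauchy-Schwarz for the form gives |g|^4 = <g, K f>^2 \<le> <g, K g> <f, K
  f> \<le> q^2 |g|^2 |f|^2, and |g|^2 cancels unless it is 0.\<close>

lemma kernel_norm_leI: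
  assumes q: "0 \<le> q" and form: "\<And>f. f \<in> L02 M \<Longrightarrow> L2_inner M f (kernel_op K f) \<le> q * L2_inner M f f"
  shows "kernel_norm M K \<le> q"
proof (rule kernel_norm_le)
  fix f assume f: "f \<in> L02 M" "L2_norm M f \<le> 1"
  define g where "g = kernel_op K f"
  have g: "g \<in> L02 M" unfolding g_def by (rule op_L02[OF f(1)])
  have "(L2_inner M g g)\<^sup>2 \<le> L2_inner M g (kernel_op K g) * L2_inner M f (kernel_op K f)"
    using op_Cauchy_Schwarz[OF g f(1)] by (simp add: g_def)
  also have "\<dots> \<le> (q * L2_inner M g g) * (q * L2_inner M f f)"
    using f(1) g q by (intro mult_mono form positive mult_nonneg_nonneg L2_inner_nonneg)
  also have "\<dots> = L2_inner M g g * (q\<^sup>2 * (L2_norm M f)\<^sup>2)"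
    by (simp flip: L2_norm_square add: power2_eq_square mult_ac)
  finally have "L2_inner M g g * L2_inner M g g \<le> L2_inner M g g * (q\<^sup>2 * (L2_norm M f)\<^sup>2)"
    by (simp add: power2_eq_square)
  then have "L2_inner M g g \<le> q\<^sup>2 * (L2_norm M f)\<^sup>2"
    using L2_inner_nonneg[of g] by (cases "L2_inner M g g = 0") auto
  then have "(L2_norm M g)\<^sup>2 \<le> (q * L2_norm M f)\<^sup>2"
    by (simp add: L2_norm_square power_mult_distrib)
  then have "L2_norm M g \<le> q * L2_norm M f"
    by (rule power2_le_imp_le) (simp add: q L2_norm_nonneg)
  also have "\<dots> \<le> q" using f(2) q by (simp add: mult_left_le)
  finally show "L2_norm M (kernel_op K f) \<le> q" by (simp add: g_def)
qed

lemma dirichlet_form_nonneg: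
  assumes "f \<in> L02 M" "kernel_norm M K \<le> 1"
  shows "0 \<le> dirichlet_form M K f"
proof -
  have "L2_inner M f (kernel_op K f) \<le> kernel_norm M K * L2_inner M f f"
    by (rule form_le_kernel_norm[OF assms(1)])
  also have "\<dots> \<le> L2_inner M f f"
    using assms(2) L2_inner_nonneg by (simp add: mult_left_le_one_le kernel_norm_nonneg)
  finally show ?thesis by (simp add: dirichlet_form_def L2_norm_square)
qed

text \<open>\<open>green f\<close> is the quadratic form of \<open>(I - K)\<inverse>\<close> at \<open>f\<close>, written as a Neumann series.
  It is the supremum of \<open>2 \<langle>f, g\<rangle> - \<E>(g)\<close> over \<open>g\<close>, approached along the partial sums of
  the series, so it is antitone in the Dirichlet form.\<close>

definition green :: "('a \<Rightarrow> real) \<Rightarrow> real" where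
  "green f = (\<Sum>k. L2_inner M f ((kernel_op K ^^ k) f))"

definition green_sum :: "('a \<Rightarrow> real) \<Rightarrow> nat \<Rightarrow> 'a \<Rightarrow> real" where
  "green_sum f t x = (\<Sum>k<t. (kernel_op K ^^ k) f x)"

lemma green_sum_L02: "f \<in> L02 M \<Longrightarrow> green_sum f t \<in> L02 M"
  unfolding green_sum_def[abs_def] by (intro L02_sum op_iter_L02) auto

lemma L2_inner_green_sum: "f \<in> L02 M \<Longrightarrow> h \<in> L02 M \<Longrightarrow>
    L2_inner M h (green_sum f t) = (\<Sum>k<t. L2_inner M h ((kernel_op K ^^ k) f))"
  unfolding green_sum_def[abs_def] L2_inner_commute[of h] by (intro L2_inner_sum op_iter_L02) auto

text \<open>Weak form of (I - K)(I + K + ... + K^(t-1)) f = f - K^t f: the partial sums solve the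
  Poisson equation (I - K) g = f up to the error K^t f. With K moved onto h, only a telescoping sum
  of numbers is left.\<close>

lemma green_sum_telescope:
  assumes f: "f \<in> L02 M" and h: "h \<in> L02 M"
  shows "L2_inner M h (green_sum f t) - L2_inner M h (kernel_op K (green_sum f t)) =
    L2_inner M h f - L2_inner M h ((kernel_op K ^^ t) f)"
proof -
  have "L2_inner M h (kernel_op K (green_sum f t)) = L2_inner M (kernel_op K h) (green_sum f t)"
    using self_adjoint[OF h green_sum_L02[OF f]] by simp
  also have "\<dots> = (\<Sum>k<t. L2_inner M h ((kernel_op K ^^ Suc k) f))"
    using f h by (simp add: L2_inner_green_sum op_L02 self_adjoint op_iter_L02)
  finally show ?thesis
    using sum_lessThan_telescope'[of "\<lambda>k. L2_inner M h ((kernel_op K ^^ k) f)" t] f h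
    by (simp add: L2_inner_green_sum sum_subtractf)
qed

context
  assumes norm_less_1: "kernel_norm M K < 1"
begin

lemma summable_norm_power: "summable (\<lambda>k. C * kernel_norm M K ^ k)"
  using norm_less_1 kernel_norm_nonneg by (intro summable_mult summable_geometric) auto

lemma summable_green:
  assumes f: "f \<in> L02 M"
  shows "summable (\<lambda>k. L2_inner M f ((kernel_op K ^^ k) f))"
  by (rule summable_comparison_test'[OF summable_norm_power])
    (use inner_iter_bound[OF f f] in auto)

lemma inner_iter_tendsto_0:
  assumes f: "f \<in> L02 M" and g: "g \<in> L02 M"
  shows "(\<lambda>k. L2_inner M g ((kernel_op K ^^ k) f)) \<longlonglongrightarrow> 0"
  by (rule Lim_null_comparison[OF _ summable_LIMSEQ_zero[OF
        summable_norm_power[of "L2_norm M g * L2_norm M f"]]])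
    (use inner_iter_bound[OF f g] in \<open>auto intro!: always_eventually\<close>)

lemma inner_green_sum_tendsto:
  assumes f: "f \<in> L02 M"
  shows "(\<lambda>t. L2_inner M f (green_sum f t)) \<longlonglongrightarrow> green f"
  using summable_LIMSEQ[OF summable_green[OF f]] f by (simp add: L2_inner_green_sum green_def)

text \<open>The crude bound lets the partial sums grow linearly in t, but \<open>K^t f\<close>
  decays geometrically: each of the t terms is at most N^t |f|^2 with N the norm of K, and t N^t
  tends to 0.\<close>

lemma inner_iter_green_sum_tendsto_0:
  assumes f: "f \<in> L02 M"
  shows "(\<lambda>t. L2_inner M (green_sum f t) ((kernel_op K ^^ t) f)) \<longlonglongrightarrow> 0"
proof (rule Lim_null_comparison)
  let ?N = "kernel_norm M K" and ?F = "L2_norm M f"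
  have N: "0 \<le> ?N" "?N \<le> 1" using kernel_norm_nonneg norm_less_1 by auto
  have "norm (L2_inner M (green_sum f t) ((kernel_op K ^^ t) f)) \<le> ?F\<^sup>2 * (of_nat t * ?N ^ t)" for t
  proof -
    have "\<bar>L2_inner M (green_sum f t) ((kernel_op K ^^ t) f)\<bar> \<le>
        (\<Sum>k<t. \<bar>L2_inner M ((kernel_op K ^^ t) f) ((kernel_op K ^^ k) f)\<bar>)"
      using f by (simp add: L2_inner_commute[of "green_sum f t"] L2_inner_green_sum op_iter_L02)
    also have "\<dots> \<le> (\<Sum>k<t. ?N ^ t * ?F\<^sup>2)"
    proof (rule sum_mono)
      fix k
      have "\<bar>L2_inner M ((kernel_op K ^^ t) f) ((kernel_op K ^^ k) f)\<bar>
          \<le> L2_norm M ((kernel_op K ^^ t) f) * ?F * ?N ^ k"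
        using f by (intro inner_iter_bound op_iter_L02)
      also have "\<dots> \<le> (?N ^ t * ?F) * ?F * 1"
        using f N by (intro mult_mono op_iter_norm_le power_le_one)
          (auto simp: L2_norm_nonneg kernel_norm_nonneg)
      finally show "\<bar>L2_inner M ((kernel_op K ^^ t) f) ((kernel_op K ^^ k) f)\<bar> \<le> ?N ^ t * ?F\<^sup>2"
        by (simp add: power2_eq_square mult.assoc)
    qed
    finally show ?thesis by (simp add: mult_ac)
  qed
  then show "\<forall>\<^sub>F t in sequentially.
      norm (L2_inner M (green_sum f t) ((kernel_op K ^^ t) f)) \<le> ?F\<^sup>2 * (of_nat t * ?N ^ t)"
    by simp
  show "(\<lambda>t. ?F\<^sup>2 * (of_nat t * ?N ^ t)) \<longlonglongrightarrow> 0"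
    using tendsto_mult_left[OF powser_times_n_limit_0[of ?N], of "?F\<^sup>2"] norm_less_1 N by simp
qed

lemma dirichlet_form_green_sum:
  assumes f: "f \<in> L02 M"
  shows "dirichlet_form M K (green_sum f t) =
    L2_inner M f (green_sum f t) - L2_inner M (green_sum f t) ((kernel_op K ^^ t) f)"
  using green_sum_telescope[OF f green_sum_L02[OF f], of t t]
  by (simp add: dirichlet_form_def L2_norm_square L2_inner_commute[of f])

text \<open>Completing the square. For an exact solution G of (I - K) G = f the claim is
  nonnegativity of the Dirichlet form at g - G. Here G is the partial sum of length t, so the
  expansion carries error terms in \<open>K^t f\<close>, which vanish as t grows.\<close>

lemma green_variational_upper:
  assumes f: "f \<in> L02 M" and g: "g \<in> L02 M"
  shows "2 * L2_inner M f g - dirichlet_form M K g \<le> green f"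
proof (rule LIMSEQ_le_const)
  let ?G = "green_sum f" and ?T = "\<lambda>t. (kernel_op K ^^ t) f"
  show "(\<lambda>t. 2 * L2_inner M g (?T t) + (L2_inner M f (?G t) - L2_inner M (?G t) (?T t))) \<longlonglongrightarrow> green f"
    using tendsto_add[OF tendsto_mult_left[OF inner_iter_tendsto_0[OF f g], of 2]
      tendsto_diff[OF inner_green_sum_tendsto[OF f] inner_iter_green_sum_tendsto_0[OF f]]] by simp
  have "2 * L2_inner M f g - dirichlet_form M K g
      \<le> 2 * L2_inner M g (?T t) + (L2_inner M f (?G t) - L2_inner M (?G t) (?T t))" for t
  proof -
    define G where "G = ?G t"
    have G: "G \<in> L02 M" unfolding G_def by (rule green_sum_L02[OF f])
    define h where "h = (\<lambda>x. 1 * g x + (-1) * G x)"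
    have h: "h \<in> L02 M" unfolding h_def by (rule L02_lincomb[OF g G])
    have lin: "L2_inner M h k = L2_inner M g k - L2_inner M G k"
      "L2_inner M (kernel_op K h) k = L2_inner M (kernel_op K g) k - L2_inner M (kernel_op K G) k"
      if "k \<in> L02 M" for k
      using L2_inner_lincomb_left[OF g G that, of 1 "-1"] op_inner_lincomb[OF g G that, of 1 "-1"]
      by (simp_all add: h_def)
    have 1: "L2_inner M h h = L2_inner M g g - 2 * L2_inner M g G + L2_inner M G G"
      using lin(1)[OF h] lin(1)[OF g] lin(1)[OF G] L2_inner_commute[of g h] L2_inner_commute[of G h]
        L2_inner_commute[of g G] by linarith
    have 2: "L2_inner M h (kernel_op K h) =
        L2_inner M g (kernel_op K g) - 2 * L2_inner M g (kernel_op K G) + L2_inner M G (kernel_op K G)"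
      using lin(2)[OF h] lin(1)[OF op_L02[OF g]] lin(1)[OF op_L02[OF G]] self_adjoint[OF g G]
        L2_inner_commute[of h "kernel_op K h"] L2_inner_commute[of h "kernel_op K g"]
        L2_inner_commute[of h "kernel_op K G"] L2_inner_commute[of G "kernel_op K g"]
      by linarith
    have "0 \<le> dirichlet_form M K h"
      using h norm_less_1 by (intro dirichlet_form_nonneg) auto
    also have "\<dots> = dirichlet_form M K g
        - 2 * (L2_inner M g G - L2_inner M g (kernel_op K G)) + dirichlet_form M K G"
      unfolding dirichlet_form_def L2_norm_square 1 2 by simp
    finally show ?thesis
      using green_sum_telescope[OF f g, of t] dirichlet_form_green_sum[OF f, of t]
      by (simp add: G_def L2_inner_commute[of f g])
  qed
  then show "\<exists>N. \<forall>t\<ge>N. 2 * L2_inner M f g - dirichlet_form M K g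
      \<le> 2 * L2_inner M g (?T t) + (L2_inner M f (?G t) - L2_inner M (?G t) (?T t))"
    by blast
qed

lemma green_variational_tendsto:
  assumes f: "f \<in> L02 M"
  shows "(\<lambda>t. 2 * L2_inner M f (green_sum f t) - dirichlet_form M K (green_sum f t)) \<longlonglongrightarrow> green f"
  using tendsto_add[OF inner_green_sum_tendsto[OF f] inner_iter_green_sum_tendsto_0[OF f]] f
  by (simp add: dirichlet_form_green_sum)

end

end

text \<open>The Dirichlet form is quadratic, so the variational expression of L at c g is c (2 <f,
  g> - c \<E>_L(g)), which is at least c times the expression of K at g. Taking the supremum over g
  yields the factor c; the case c = 1 is plain monotonicity.\<close>

lemma green_comparison:
  assumes K: "positive_kernel M K" "kernel_norm M K < 1"
    and L: "positive_kernel M L" "kernel_norm M L < 1"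
    and c: "0 < c" and le: "\<And>g. g \<in> L02 M \<Longrightarrow> c * dirichlet_form M L g \<le> dirichlet_form M K g"
    and f: "f \<in> L02 M"
  shows "c * positive_kernel.green M K f \<le> positive_kernel.green M L f"
proof -
  interpret K: positive_kernel M K by fact
  interpret L: positive_kernel M L by fact
  have "2 * L2_inner M f g - dirichlet_form M K g \<le> L.green f / c" if g: "g \<in> L02 M" for g
  proof -
    have "2 * L2_inner M f (\<lambda>x. c * g x) - dirichlet_form M L (\<lambda>x. c * g x) \<le> L.green f"
      by (rule L.green_variational_upper[OF L(2) f K.L02_scale[OF g]])
    moreover have "dirichlet_form M L (\<lambda>x. c * g x) = c * (c * dirichlet_form M L g)"
      by (simp add: dirichlet_form_def K.L2_norm_square L.op_scale K.L2_inner_scale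
        K.L2_inner_scale_right algebra_simps)
    ultimately have calc: "c * (2 * L2_inner M f g - c * dirichlet_form M L g) \<le> L.green f"
      by (simp add: K.L2_inner_scale_right algebra_simps)
    have "c * (2 * L2_inner M f g - dirichlet_form M K g)
        \<le> c * (2 * L2_inner M f g - c * dirichlet_form M L g)"
      using c le[OF g] by (intro mult_left_mono) auto
    also note calc
    finally show ?thesis using c by (simp add: pos_le_divide_eq mult.commute)
  qed
  then have "K.green f \<le> L.green f / c"
    using K.green_sum_L02[OF f]
    by (intro LIMSEQ_le_const2[OF K.green_variational_tendsto[OF K(2) f]]) auto
  then show ?thesis using c by (simp add: pos_le_divide_eq mult.commute)
qed


section \<open>The stationary chain\<close>

context invariant_kernel
begin

sublocale IT: Ionescu_Tulcea "chain_step M K" "\<lambda>_. M"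
proof (rule Ionescu_Tulcea.intro)
  fix i :: nat
  show "chain_step M K i \<in> Pi\<^sub>M {0..<i} (\<lambda>_. M) \<rightarrow>\<^sub>M subprob_algebra M"
  proof (cases i)
    case 0
    then show ?thesis using M_in_subprob by (simp add: chain_step_def[abs_def])
  next
    case (Suc t)
    have "(\<lambda>h. h t) \<in> Pi\<^sub>M {0..<i} (\<lambda>_. M) \<rightarrow>\<^sub>M M"
      using Suc by (intro measurable_component_singleton) auto
    then have "(\<lambda>h. K (h t)) \<in> Pi\<^sub>M {0..<i} (\<lambda>_. M) \<rightarrow>\<^sub>M subprob_algebra M"
      by (rule measurable_compose[OF _ K_subprob])
    then show ?thesis by (simp add: chain_step_def[abs_def] Suc)
  qed
next
  show "prob_space (chain_step M K i h)" if "h \<in> space (Pi\<^sub>M {0..<i} (\<lambda>_. M))" for i h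
    using that by (cases i) (auto simp: chain_step_def space_PiM intro: prob_space_axioms K_prob_space)
qed

abbreviation "chain \<equiv> chain_law M K"

lemma chain_eq: "chain = IT.PF.lim"
  by (simp add: chain_law_def)

lemma sets_chain[measurable_cong]: "sets chain = sets (Pi\<^sub>M UNIV (\<lambda>_. M))"
  by (simp add: chain_eq)

lemma measurable_coord[measurable]: "(\<lambda>\<xi>. \<xi> s) \<in> chain \<rightarrow>\<^sub>M M"
  by measurable

text \<open>The trajectory law is a projective limit, known through its finite-dimensional
  marginals. Its initial segments are the finite step-by-step constructions started from the empty
  history, where one-step integration applies.\<close>

lemma history_eq: "distr chain (Pi\<^sub>M {0..<n} (\<lambda>_. M)) (\<lambda>\<xi>. restrict \<xi> {0..<n}) = IT.C 0 n (\<lambda>_. undefined)"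
proof -
  have up: "IT.up_to {0..<n} = n"
    by (rule antisym) (use IT.up_to[of "{0..<n}"] in \<open>auto simp: IT.up_to_iff_Ico ivl_subset\<close>)
  have "distr chain (Pi\<^sub>M {0..<n} (\<lambda>_. M)) (\<lambda>\<xi>. restrict \<xi> {0..<n}) = IT.CI {0..<n}"
    unfolding chain_eq by (rule IT.distr_lim) simp
  also have "\<dots> = IT.C 0 n (\<lambda>_. undefined)"
    unfolding IT.CI_def up using IT.distr_C[of n n "\<lambda>_. undefined" 0] by simp
  finally show ?thesis .
qed

text \<open>The Markov property in integrated form. F also sees the earlier state at time s, which
  belongs to the history because s \<le> t; this is the form needed for covariances.\<close>

lemma nn_integral_chain_step:
  assumes [measurable]: "case_prod F \<in> borel_measurable (M \<Otimes>\<^sub>M M)" and st: "s \<le> t"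
  shows "(\<integral>\<^sup>+\<xi>. F (\<xi> s) (\<xi> (Suc t)) \<partial>chain) = (\<integral>\<^sup>+\<xi>. \<integral>\<^sup>+y. F (\<xi> s) y \<partial>K (\<xi> t) \<partial>chain)"
proof -
  let ?H = "\<lambda>n::nat. Pi\<^sub>M {0..<n} (\<lambda>_. M)" and ?C = "\<lambda>n. IT.C 0 n (\<lambda>_. undefined)"
  have hist: "(\<integral>\<^sup>+\<xi>. G (restrict \<xi> {0..<n}) \<partial>chain) = (\<integral>\<^sup>+h. G h \<partial>?C n)"
    if "G \<in> borel_measurable (?H n)" for G n
    using that by (subst history_eq[symmetric], subst nn_integral_distr) auto
  have sC: "space (?C n) = space (?H n)" for n
    using IT.space_C[of "\<lambda>_. undefined" 0 n] by (simp add: space_PiM)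
  have setC[measurable_cong]: "sets (?C n) = sets (?H n)" for n
    using IT.sets_C[of "\<lambda>_. undefined" 0 n] by (simp add: space_PiM)
  have "(\<lambda>h. h u) \<in> ?H n \<rightarrow>\<^sub>M M" if "u < n" for u n :: nat
    by (rule measurable_component_singleton) (use that in simp)
  from this[of s "Suc (Suc t)"] this[of "Suc t" "Suc (Suc t)"] this[of s "Suc t"] this[of t "Suc t"] st
  have [measurable]: "(\<lambda>h. h s) \<in> ?H (Suc (Suc t)) \<rightarrow>\<^sub>M M" "(\<lambda>h. h (Suc t)) \<in> ?H (Suc (Suc t)) \<rightarrow>\<^sub>M M"
    "(\<lambda>h. h s) \<in> ?H (Suc t) \<rightarrow>\<^sub>M M" "(\<lambda>h. h t) \<in> ?H (Suc t) \<rightarrow>\<^sub>M M"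
    by auto
  have m1[measurable]: "(\<lambda>h. F (h s) (h (Suc t))) \<in> borel_measurable (?H (Suc (Suc t)))"
    by measurable
  have m2[measurable]: "(\<lambda>h. \<integral>\<^sup>+y. F (h s) y \<partial>K (h t)) \<in> borel_measurable (?H (Suc t))"
    by (intro nn_integral_measurable_subprob_algebra2[where N=M]) measurable
  have "(\<integral>\<^sup>+\<xi>. F (\<xi> s) (\<xi> (Suc t)) \<partial>chain) = (\<integral>\<^sup>+h. F (h s) (h (Suc t)) \<partial>?C (Suc (Suc t)))"
    using st by (subst hist[OF m1, symmetric]) simp
  also have "\<dots> = (\<integral>\<^sup>+h. \<integral>\<^sup>+h'. F (h' s) (h' (Suc t)) \<partial>IT.eP (Suc t) h \<partial>?C (Suc t))"
  proof -
    have "IT.eP (Suc t) \<in> ?C (Suc t) \<rightarrow>\<^sub>M subprob_algebra (?H (Suc (Suc t)))"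
      unfolding measurable_cong_sets[OF setC refl] by (rule IT.measurable_eP)
    from nn_integral_bind[OF m1 this] show ?thesis
      by (simp only: IT.C.simps(2)[of 0 "Suc t"] add_0)
  qed
  also have "\<dots> = (\<integral>\<^sup>+h. \<integral>\<^sup>+y. F (h s) y \<partial>K (h t) \<partial>?C (Suc t))"
  proof (rule nn_integral_cong)
    fix h assume "h \<in> space (?C (Suc t))"
    then have h: "h \<in> space (?H (Suc t))" by (simp only: sC)
    show "(\<integral>\<^sup>+h'. F (h' s) (h' (Suc t)) \<partial>IT.eP (Suc t) h) = (\<integral>\<^sup>+y. F (h s) y \<partial>K (h t))"
      using st by (subst IT.nn_integral_eP[OF h m1]) (simp add: chain_step_def)
  qed
  also have "\<dots> = (\<integral>\<^sup>+\<xi>. \<integral>\<^sup>+y. F (\<xi> s) y \<partial>K (\<xi> t) \<partial>chain)"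
    using st by (subst hist[OF m2, symmetric]) (simp only: restrict_apply atLeastLessThan_iff, simp)
  finally show ?thesis .
qed

lemma nn_integral_chain_0:
  assumes [measurable]: "f \<in> borel_measurable M"
  shows "(\<integral>\<^sup>+\<xi>. f (\<xi> 0) \<partial>chain) = (\<integral>\<^sup>+x. f x \<partial>M)"
proof -
  let ?H = "Pi\<^sub>M {0..<Suc 0} (\<lambda>_. M)"
  have C1: "IT.C 0 (Suc 0) (\<lambda>_. undefined) = IT.eP 0 (\<lambda>_. undefined)"
    using bind_return[OF IT.measurable_eP[of 0], of "\<lambda>_. undefined"] by (simp add: space_PiM)
  have m[measurable]: "(\<lambda>h. f (h 0)) \<in> borel_measurable ?H" by measurable
  have "(\<integral>\<^sup>+\<xi>. f (\<xi> 0) \<partial>chain) = (\<integral>\<^sup>+h. f (h 0) \<partial>distr chain ?H (\<lambda>\<xi>. restrict \<xi> {0..<Suc 0}))"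
    by (subst nn_integral_distr) auto
  also have "\<dots> = (\<integral>\<^sup>+x. f x \<partial>M)"
    unfolding history_eq C1 by (subst IT.nn_integral_eP[OF _ m]) (auto simp: chain_step_def space_PiM)
  finally show ?thesis .
qed

text \<open>Stationarity: each step of the induction is absorbed by the invariance
  \<open>M \<bind> K = M\<close>.\<close>

lemma nn_integral_chain_coord:
  assumes "f \<in> borel_measurable M"
  shows "(\<integral>\<^sup>+\<xi>. f (\<xi> s) \<partial>chain) = (\<integral>\<^sup>+x. f x \<partial>M)"
  using assms
proof (induction s arbitrary: f)
  case 0
  then show ?case by (rule nn_integral_chain_0)
next
  case (Suc s)
  note [measurable] = Suc.prems
  have "(\<integral>\<^sup>+\<xi>. f (\<xi> (Suc s)) \<partial>chain) = (\<integral>\<^sup>+\<xi>. \<integral>\<^sup>+y. f y \<partial>K (\<xi> s) \<partial>chain)"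
    by (rule nn_integral_chain_step[where F="\<lambda>_ y. f y", OF _ order_refl]) measurable
  also have "\<dots> = (\<integral>\<^sup>+x. \<integral>\<^sup>+y. f y \<partial>K x \<partial>M)"
    by (rule Suc.IH) (intro nn_integral_measurable_subprob_algebra2[where N=M], measurable)
  also have "\<dots> = (\<integral>\<^sup>+x. f x \<partial>M)"
    using nn_integral_bind[OF Suc.prems K_subprob] by (simp add: invariant)
  finally show ?case .
qed

lemma distr_chain_coord: "distr chain M (\<lambda>\<xi>. \<xi> s) = M"
proof (rule measure_eqI)
  fix A assume "A \<in> sets (distr chain M (\<lambda>\<xi>. \<xi> s))"
  then have [measurable]: "A \<in> sets M" by simp
  have "emeasure (distr chain M (\<lambda>\<xi>. \<xi> s)) A = (\<integral>\<^sup>+x. indicator A x \<partial>distr chain M (\<lambda>\<xi>. \<xi> s))"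
    by simp
  also have "\<dots> = (\<integral>\<^sup>+\<xi>. indicator A (\<xi> s) \<partial>chain)"
    by (rule nn_integral_distr[OF measurable_coord]) simp
  also have "\<dots> = emeasure M A"
    by (subst nn_integral_chain_coord) auto
  finally show "emeasure (distr chain M (\<lambda>\<xi>. \<xi> s)) A = emeasure M A" .
qed simp

lemma prob_space_chain: "prob_space chain"
  using distr_chain_coord[of 0] by (intro prob_space_distrD[of "\<lambda>\<xi>. \<xi> 0" chain M])
    (auto simp: prob_space_axioms)

sublocale chain: prob_space chain by (rule prob_space_chain)

lemma
  fixes f :: "'x \<Rightarrow> real"
  assumes "f \<in> borel_measurable M"
  shows integrable_chain_coord: "integrable chain (\<lambda>\<xi>. f (\<xi> s)) \<longleftrightarrow> integrable M f"
    and integral_chain_coord: "(\<integral>\<xi>. f (\<xi> s) \<partial>chain) = (\<integral>x. f x \<partial>M)"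
  using integrable_distr_eq[OF measurable_coord assms, of s] integral_distr[OF measurable_coord assms, of s]
  by (simp_all add: distr_chain_coord)

lemma integrable_chain_mult:
  assumes "f \<in> L02 M" "g \<in> L02 M"
  shows "integrable chain (\<lambda>\<xi>. f (\<xi> s) * g (\<xi> t))"
proof (rule square_integrable_mult)
  note [measurable] = assms[THEN L02_measurable]
  show "(\<lambda>\<xi>. f (\<xi> s)) \<in> borel_measurable chain" "(\<lambda>\<xi>. g (\<xi> t)) \<in> borel_measurable chain"
    by measurable
  show "integrable chain (\<lambda>\<xi>. (f (\<xi> s))\<^sup>2)" "integrable chain (\<lambda>\<xi>. (g (\<xi> t))\<^sup>2)"
    using assms[THEN L02_square] by (subst integrable_chain_coord; simp)+
qed

text \<open>The Markov property as an identity of measures: the products in a covariance change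
  sign, and a \<open>bind\<close> makes them accessible to \<open>integral_bind_kernel\<close>,
  where nonnegative integrals would not suffice.\<close>

lemma chain_pair_step:
  assumes st: "s \<le> t"
  shows "distr chain (M \<Otimes>\<^sub>M M) (\<lambda>\<xi>. (\<xi> s, \<xi> (Suc t))) =
    Giry_Monad.bind (distr chain (M \<Otimes>\<^sub>M M) (\<lambda>\<xi>. (\<xi> s, \<xi> t)))
      (\<lambda>p. distr (K (snd p)) (M \<Otimes>\<^sub>M M) (Pair (fst p)))"
    (is "?L = Giry_Monad.bind ?D ?N")
proof (rule measure_eqI)
  have N: "?N \<in> M \<Otimes>\<^sub>M M \<rightarrow>\<^sub>M subprob_algebra (M \<Otimes>\<^sub>M M)"
    by (intro measurable_prob_algebraD measurable_distr_prob_space2[where M=M]) measurable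
  have ne: "space ?D \<noteq> {}" using not_empty by (simp add: space_pair_measure)
  have sets: "sets (?D \<bind> ?N) = sets (M \<Otimes>\<^sub>M M)"
    using ne by (intro sets_bind) auto
  then show "sets ?L = sets (?D \<bind> ?N)" by simp
  fix A assume "A \<in> sets ?L"
  then have A[measurable]: "A \<in> sets (M \<Otimes>\<^sub>M M)" by simp
  have "emeasure ?L A = (\<integral>\<^sup>+p. indicator A p \<partial>?L)" by simp
  also have "\<dots> = (\<integral>\<^sup>+\<xi>. indicator A (\<xi> s, \<xi> (Suc t)) \<partial>chain)"
    by (rule nn_integral_distr) measurable
  also have "\<dots> = (\<integral>\<^sup>+\<xi>. \<integral>\<^sup>+y. indicator A (\<xi> s, y) \<partial>K (\<xi> t) \<partial>chain)"
    by (rule nn_integral_chain_step[where F="\<lambda>x y. indicator A (x, y)", OF _ st]) simp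
  also have "\<dots> = (\<integral>\<^sup>+\<xi>. \<integral>\<^sup>+q. indicator A q \<partial>?N (\<xi> s, \<xi> t) \<partial>chain)"
  proof (rule nn_integral_cong)
    fix \<xi> assume "\<xi> \<in> space chain"
    then have "\<xi> s \<in> space M" "\<xi> t \<in> space M"
      using measurable_space[OF measurable_coord] by auto
    then have "Pair (\<xi> s) \<in> K (\<xi> t) \<rightarrow>\<^sub>M M \<Otimes>\<^sub>M M"
      using measurable_cong_sets[OF K_sets refl, of "\<xi> t" "M \<Otimes>\<^sub>M M"] by auto
    then show "(\<integral>\<^sup>+y. indicator A (\<xi> s, y) \<partial>K (\<xi> t)) = (\<integral>\<^sup>+q. indicator A q \<partial>?N (\<xi> s, \<xi> t))"
      by (subst nn_integral_distr) auto
  qed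
  also have "\<dots> = (\<integral>\<^sup>+p. \<integral>\<^sup>+q. indicator A q \<partial>?N p \<partial>?D)"
    by (rule nn_integral_distr[symmetric])
      (measurable, intro measurable_compose[OF N] nn_integral_measurable_subprob_algebra, measurable)
  also have "\<dots> = (\<integral>\<^sup>+q. indicator A q \<partial>(?D \<bind> ?N))"
    by (rule nn_integral_bind[symmetric, where B="M \<Otimes>\<^sub>M M"]) (use N in auto)
  also have "\<dots> = emeasure (?D \<bind> ?N) A"
    by (rule nn_integral_indicator) (simp add: sets)
  finally show "emeasure ?L A = emeasure (?D \<bind> ?N) A" .
qed

lemma chain_covariance_step:
  assumes f: "f \<in> L02 M" and g: "g \<in> L02 M" and st: "s \<le> t"
  shows "(\<integral>\<xi>. f (\<xi> s) * g (\<xi> (Suc t)) \<partial>chain) = (\<integral>\<xi>. f (\<xi> s) * kernel_op K g (\<xi> t) \<partial>chain)"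
proof -
  let ?P = "M \<Otimes>\<^sub>M M"
  let ?L = "distr chain ?P (\<lambda>\<xi>. (\<xi> s, \<xi> (Suc t)))" and ?D = "distr chain ?P (\<lambda>\<xi>. (\<xi> s, \<xi> t))"
  let ?N = "\<lambda>p. distr (K (snd p)) ?P (Pair (fst p))" and ?h = "\<lambda>p. f (fst p) * g (snd p)"
  note [measurable] = f[THEN L02_measurable] g[THEN L02_measurable]
  have N: "?N \<in> ?D \<rightarrow>\<^sub>M subprob_algebra ?P"
    by (intro measurable_prob_algebraD measurable_distr_prob_space2[where M=M]) measurable
  have ne: "space ?D \<noteq> {}" using not_empty by (simp add: space_pair_measure)
  have h[measurable]: "?h \<in> borel_measurable ?P" by measurable
  have "integrable ?L ?h"
    using integrable_chain_mult[OF f g, of s "Suc t"] by (subst integrable_distr_eq) auto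
  then have int: "integrable (?D \<bind> ?N) ?h" by (simp only: chain_pair_step[OF st])
  have "(\<integral>\<xi>. f (\<xi> s) * g (\<xi> (Suc t)) \<partial>chain) = (\<integral>p. ?h p \<partial>?L)"
    by (subst integral_distr) auto
  also have "\<dots> = (\<integral>p. \<integral>q. ?h q \<partial>?N p \<partial>?D)"
    unfolding chain_pair_step[OF st] by (rule integral_bind_kernel[OF N ne int])
  also have "\<dots> = (\<integral>p. f (fst p) * kernel_op K g (snd p) \<partial>?D)"
  proof (rule Bochner_Integration.integral_cong[OF refl])
    fix p assume "p \<in> space ?D"
    then have p: "fst p \<in> space M" "snd p \<in> space M" by (auto simp: space_pair_measure)
    then have "Pair (fst p) \<in> K (snd p) \<rightarrow>\<^sub>M ?P"
      using measurable_cong_sets[OF K_sets refl, of "snd p" ?P] by auto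
    from integral_distr[OF this h]
    have "(\<integral>q. ?h q \<partial>?N p) = (\<integral>y. f (fst p) * g y \<partial>K (snd p))"
      by (simp only: fst_conv snd_conv)
    then show "(\<integral>q. ?h q \<partial>?N p) = f (fst p) * kernel_op K g (snd p)"
      by (simp add: kernel_op_def)
  qed
  also have "\<dots> = (\<integral>\<xi>. f (\<xi> s) * kernel_op K g (\<xi> t) \<partial>chain)"
  proof -
    have [measurable]: "kernel_op K g \<in> borel_measurable M"
      by (intro measurable_op L02_measurable g)
    have 1: "(\<lambda>p. f (fst p) * kernel_op K g (snd p)) \<in> borel_measurable ?P"
      by measurable
    have 2: "(\<lambda>\<xi>. (\<xi> s, \<xi> t)) \<in> chain \<rightarrow>\<^sub>M ?P"
      by measurable
    show ?thesis using integral_distr[OF 2 1] by simp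
  qed
  finally show ?thesis .
qed

lemma chain_covariance:
  assumes f: "f \<in> L02 M" and g: "g \<in> L02 M"
  shows "(\<integral>\<xi>. f (\<xi> s) * g (\<xi> (s + k)) \<partial>chain) = L2_inner M f ((kernel_op K ^^ k) g)"
  using g
proof (induction k arbitrary: g)
  case 0
  have "(\<lambda>x. f x * g x) \<in> borel_measurable M"
    using f[THEN L02_measurable] 0[THEN L02_measurable] by measurable
  then show ?case
    using integral_chain_coord[of "\<lambda>x. f x * g x" s] by (simp add: L2_inner_def)
next
  case (Suc k)
  have "(\<integral>\<xi>. f (\<xi> s) * g (\<xi> (s + Suc k)) \<partial>chain) = (\<integral>\<xi>. f (\<xi> s) * kernel_op K g (\<xi> (s + k)) \<partial>chain)"
    using chain_covariance_step[OF f Suc.prems, of s "s + k"] by simp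
  also have "\<dots> = L2_inner M f ((kernel_op K ^^ k) (kernel_op K g))"
    by (rule Suc.IH[OF op_L02[OF Suc.prems]])
  finally show ?case by (simp add: funpow_swap1)
qed

text \<open>Increments are simpler than the variance itself: adding one term contributes |f|^2 and
  twice its covariances with the t earlier terms. Letting the sum start at k = 0 counts |f|^2 twice,
  hence the subtraction; the limit of the increments is then visible.\<close>

lemma chain_variance_Suc:
  fixes t :: nat
  assumes f: "f \<in> L02 M"
  defines "V \<equiv> \<lambda>t::nat. chain.variance (\<lambda>\<xi>. \<Sum>s=1..t. f (\<xi> s))"
  shows "V (Suc t) = V t + 2 * (\<Sum>k<Suc t. L2_inner M f ((kernel_op K ^^ k) f)) - L2_inner M f f"
proof -
  let ?S = "\<lambda>t::nat. \<lambda>\<xi>. \<Sum>s=1..t. f (\<xi> s)"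
  note [measurable] = L02_measurable[OF f]
  have mean: "(\<integral>\<xi>. ?S t \<xi> \<partial>chain) = 0" for t
    using L02_integrable[OF f] L02_mean[OF f]
    by (subst Bochner_Integration.integral_sum) (auto simp: integrable_chain_coord integral_chain_coord)
  note int = integrable_chain_mult[OF f f]
  have intS: "integrable chain (\<lambda>\<xi>. ?S t \<xi> * f (\<xi> u))" for t u
    unfolding sum_distrib_right using int by (intro Bochner_Integration.integrable_sum)
  have intSS: "integrable chain (\<lambda>\<xi>. (?S t \<xi>)\<^sup>2)" for t
    unfolding power2_eq_square sum_distrib_left using intS by (intro Bochner_Integration.integrable_sum)
  have V: "V t = (\<integral>\<xi>. (?S t \<xi>)\<^sup>2 \<partial>chain)" for t
    by (simp only: V_def mean diff_0_right)
  have cross: "(\<integral>\<xi>. ?S t \<xi> * f (\<xi> (Suc t)) \<partial>chain) = (\<Sum>k=1..t. L2_inner M f ((kernel_op K ^^ k) f))"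
  proof -
    have "(\<integral>\<xi>. ?S t \<xi> * f (\<xi> (Suc t)) \<partial>chain) = (\<Sum>s=1..t. \<integral>\<xi>. f (\<xi> s) * f (\<xi> (Suc t)) \<partial>chain)"
      unfolding sum_distrib_right by (rule Bochner_Integration.integral_sum) (rule int)
    also have "\<dots> = (\<Sum>s=1..t. L2_inner M f ((kernel_op K ^^ (Suc t - s)) f))"
    proof (rule sum.cong[OF refl])
      fix s assume "s \<in> {1..t}"
      then show "(\<integral>\<xi>. f (\<xi> s) * f (\<xi> (Suc t)) \<partial>chain) = L2_inner M f ((kernel_op K ^^ (Suc t - s)) f)"
        using chain_covariance[OF f f, of s "Suc t - s"] by simp
    qed
    also have "\<dots> = (\<Sum>k=1..t. L2_inner M f ((kernel_op K ^^ k) f))"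
      by (rule sum.reindex_bij_witness[of _ "\<lambda>s. Suc t - s" "\<lambda>s. Suc t - s"]) auto
    finally show ?thesis .
  qed
  have "V (Suc t) = (\<integral>\<xi>. (?S t \<xi>)\<^sup>2 + 2 * (?S t \<xi> * f (\<xi> (Suc t))) + f (\<xi> (Suc t)) * f (\<xi> (Suc t)) \<partial>chain)"
    unfolding V by (intro Bochner_Integration.integral_cong) (auto simp: power2_eq_square algebra_simps)
  also have "\<dots> = V t + 2 * (\<Sum>k=1..t. L2_inner M f ((kernel_op K ^^ k) f)) + L2_inner M f f"
    using intS intSS int chain_covariance[OF f f, of "Suc t" 0]
    by (simp add: V cross del: One_nat_def)
  also have "(\<Sum>k=1..t. L2_inner M f ((kernel_op K ^^ k) f)) =
      (\<Sum>k<Suc t. L2_inner M f ((kernel_op K ^^ k) f)) - L2_inner M f f"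
    by (simp add: sum.atLeast1_atMost_eq sum.lessThan_Suc_shift del: sum.lessThan_Suc)
  finally show ?thesis by simp
qed

end

section \<open>From variance increments to the asymptotic variance\<close>

lemma Cesaro_linear:
  fixes V :: "nat \<Rightarrow> real"
  assumes "(\<lambda>t. V (Suc t) - V t) \<longlonglongrightarrow> L"
  shows "(\<lambda>t. V t / real t) \<longlonglongrightarrow> L"
proof (rule LIMSEQ_I)
  fix e :: real assume e: "0 < e"
  obtain n where n: "\<And>t. t \<ge> n \<Longrightarrow> \<bar>V (Suc t) - V t - L\<bar> < e / 2"
    using LIMSEQ_D[OF assms, of "e / 2"] e by auto
  \<comment> \<open>The error accumulated up to n is a constant C; every later increment adds at
    most e/2. Once t \<ge> m, the constant is itself below t e/2, so the total stays below t
    e.\<close>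
  define C where "C = \<bar>V n - real n * L\<bar>"
  have bound: "\<bar>V t - real t * L\<bar> \<le> C + real t * (e / 2)" if "n \<le> t" for t
    using that
  proof (induction t rule: dec_induct)
    case base
    then show ?case using e by (simp add: C_def)
  next
    case (step t)
    have "\<bar>V (Suc t) - real (Suc t) * L\<bar> \<le> \<bar>V t - real t * L\<bar> + \<bar>V (Suc t) - V t - L\<bar>"
      by (simp add: algebra_simps)
    also have "\<dots> \<le> (C + real t * (e / 2)) + e / 2"
      using step.IH n[of t] step.hyps by (intro add_mono) auto
    finally show ?case by (simp add: algebra_simps add_divide_distrib)
  qed
  obtain m where m: "C < real m * (e / 2)"
    using ex_less_of_nat_mult[of "e / 2" C] e by auto
  show "\<exists>no. \<forall>t\<ge>no. norm (V t / real t - L) < e"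
  proof (intro exI allI impI)
    fix t assume t: "max (Suc n) m \<le> t"
    then have pos: "0 < real t" by simp
    have "real m * (e / 2) \<le> real t * (e / 2)" using t e by (intro mult_right_mono) auto
    then have "\<bar>V t - real t * L\<bar> < real t * e" using bound[of t] m t by auto
    moreover have "V t / real t - L = (V t - real t * L) / real t"
      using pos by (simp add: field_simps)
    ultimately show "norm (V t / real t - L) < e"
      using pos by (simp add: pos_divide_less_eq mult.commute)
  qed
qed

lemma (in positive_kernel) asymp_var_eq:
  assumes f: "f \<in> L02 M" and K: "kernel_norm M K < 1"
  shows "asymp_var M K f = 2 * green f - (L2_norm M f)\<^sup>2"
proof -
  let ?V = "\<lambda>t::nat. chain.variance (\<lambda>\<xi>. \<Sum>s=1..t. f (\<xi> s))"
  have "(\<lambda>t. \<Sum>k<Suc t. L2_inner M f ((kernel_op K ^^ k) f)) \<longlonglongrightarrow> green f"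
    unfolding green_def by (intro LIMSEQ_Suc summable_LIMSEQ summable_green[OF K f])
  then have "(\<lambda>t. 2 * (\<Sum>k<Suc t. L2_inner M f ((kernel_op K ^^ k) f)) - L2_inner M f f)
      \<longlonglongrightarrow> 2 * green f - L2_inner M f f"
    by (intro tendsto_intros)
  moreover have "?V (Suc t) - ?V t = 2 * (\<Sum>k<Suc t. L2_inner M f ((kernel_op K ^^ k) f)) - L2_inner M f f" for t
    by (subst chain_variance_Suc[OF f]) linarith
  ultimately have "(\<lambda>t. ?V t / real t) \<longlonglongrightarrow> 2 * green f - L2_inner M f f"
    by (intro Cesaro_linear) presburger
  then show ?thesis
    unfolding asymp_var_def L2_norm_square by (rule limI)
qed

section \<open>Comparison of two kernels\<close>

text \<open>Each norm bounds its own quadratic form, the comparison carries that bound to the form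
  of the other kernel, and positivity converts it back into a bound on the norm.\<close>

lemma kernel_norm_comparison:
  assumes K: "positive_kernel M K" and L: "positive_kernel M L" and c: "c \<in> {0..1}"
    and lower: "\<And>f. f \<in> L02 M \<Longrightarrow> c * dirichlet_form M L f \<le> dirichlet_form M K f"
    and upper: "\<And>f. f \<in> L02 M \<Longrightarrow> dirichlet_form M K f \<le> dirichlet_form M L f"
  shows "c * (1 - kernel_norm M L) \<le> 1 - kernel_norm M K"
    and "1 - kernel_norm M K \<le> 1 - kernel_norm M L"
proof -
  interpret K: positive_kernel M K by fact
  interpret L: positive_kernel M L by fact
  have "kernel_norm M L \<le> kernel_norm M K"
  proof (rule L.kernel_norm_leI[OF K.kernel_norm_nonneg])
    fix f assume f: "f \<in> L02 M"
    show "L2_inner M f (kernel_op L f) \<le> kernel_norm M K * L2_inner M f f"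
      using upper[OF f] K.form_le_kernel_norm[OF f] by (simp add: dirichlet_form_def)
  qed
  then show "1 - kernel_norm M K \<le> 1 - kernel_norm M L" by simp
  have "kernel_norm M K \<le> 1 - c * (1 - kernel_norm M L)"
  proof (rule K.kernel_norm_leI)
    \<comment> \<open>\<open>kernel_norm_leI\<close> asks for a nonnegative bound; here it is 1 - c
      plus c times the norm of L.\<close>
    have "0 \<le> c * kernel_norm M L" using c L.kernel_norm_nonneg by simp
    then show "0 \<le> 1 - c * (1 - kernel_norm M L)" using c by (simp add: algebra_simps)
    fix f assume f: "f \<in> L02 M"
    have "c * L2_inner M f (kernel_op L f) \<le> c * (kernel_norm M L * L2_inner M f f)"
      using c by (intro mult_left_mono L.form_le_kernel_norm[OF f]) auto
    then show "L2_inner M f (kernel_op K f) \<le> (1 - c * (1 - kernel_norm M L)) * L2_inner M f f"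
      using lower[OF f] by (simp add: dirichlet_form_def K.L2_norm_square algebra_simps)
  qed
  then show "c * (1 - kernel_norm M L) \<le> 1 - kernel_norm M K" by simp
qed

lemma asymp_var_comparison:
  assumes K: "positive_kernel M K" and L: "positive_kernel M L" and c: "c \<in> {0..1}"
    and lower: "\<And>f. f \<in> L02 M \<Longrightarrow> c * dirichlet_form M L f \<le> dirichlet_form M K f"
    and upper: "\<And>f. f \<in> L02 M \<Longrightarrow> dirichlet_form M K f \<le> dirichlet_form M L f"
    and NL: "kernel_norm M L < 1" and c0: "0 < c" and f: "f \<in> L02 M"
  shows "asymp_var M L f \<le> asymp_var M K f"
    and "asymp_var M K f \<le> inverse c * asymp_var M L f + (inverse c - 1) * (L2_norm M f)\<^sup>2"
proof -
  let ?k = "positive_kernel.green M K f" and ?l = "positive_kernel.green M L f"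
  \<comment> \<open>A positive c passes the spectral gap of L on to K, so the Neumann series of K
    converges too.\<close>
  have "0 < c * (1 - kernel_norm M L)" using NL c0 by simp
  then have NK: "kernel_norm M K < 1"
    using kernel_norm_comparison(1)[OF K L c lower upper] by linarith
  have 1: "?l \<le> ?k"
    using green_comparison[OF L NL K NK zero_less_one _ f] upper by simp
  have "c * ?k \<le> ?l"
    by (rule green_comparison[OF K NK L NL c0 lower f])
  then have 2: "?k \<le> inverse c * ?l"
    using c0 by (simp add: field_simps)
  note eq = positive_kernel.asymp_var_eq[OF K f NK] positive_kernel.asymp_var_eq[OF L f NL]
  show "asymp_var M L f \<le> asymp_var M K f"
    unfolding eq using 1 by simp
  \<comment> \<open>Both variances subtract |f|^2 with coefficient 1. Scaling that of L by 1/c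
    subtracts |f|^2 / c instead, and the additional term makes up the difference.\<close>
  show "asymp_var M K f \<le> inverse c * asymp_var M L f + (inverse c - 1) * (L2_norm M f)\<^sup>2"
    unfolding eq using 2 by (simp add: algebra_simps)
qed


section \<open>Uniform mixtures\<close>

text \<open>The common shape of \<open>gibbs_kernel\<close> and \<open>cond_gibbs_kernel\<close>.
  \<open>measure_of\<close> takes the prescribed values only if they form a measure;
  \<open>mixture_eq_bind\<close> secures this by a two-stage draw, first a uniform index i from S
  and then a point from \<open>N i\<close>.\<close>

definition mixture :: "'i set \<Rightarrow> ('i \<Rightarrow> 'x measure) \<Rightarrow> 'x measure \<Rightarrow> 'x measure" where
  "mixture S N B = measure_of (space B) (sets B) (\<lambda>A. (\<Sum>i\<in>S. emeasure (N i) A) / of_nat (card S))"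

context
  fixes S :: "'i set" and N :: "'i \<Rightarrow> 'x measure" and B :: "'x measure"
  assumes S: "finite S" "S \<noteq> {}" and N: "\<And>i. i \<in> S \<Longrightarrow> N i \<in> space (prob_algebra B)"
begin

lemma measurable_mixture_components: "N \<in> uniform_count_measure S \<rightarrow>\<^sub>M prob_algebra B"
  using N by (simp add: measurable_cong_sets[OF sets_uniform_count_measure_count_space refl])

lemma emeasure_bind_uniform:
  assumes "A \<in> sets B"
  shows "emeasure (uniform_count_measure S \<bind> N) A = (\<Sum>i\<in>S. emeasure (N i) A) / of_nat (card S)"
proof -
  have "0 < card S" using S by (simp add: card_gt_0_iff)
  then have c: "ennreal (1 / real (card S)) = inverse (of_nat (card S))"
    by (simp add: divide_inverse inverse_ennreal ennreal_of_nat_eq_real_of_nat)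
  have "emeasure (uniform_count_measure S \<bind> N) A = (\<integral>\<^sup>+i. emeasure (N i) A \<partial>uniform_count_measure S)"
    using S assms measurable_prob_algebraD[OF measurable_mixture_components]
    by (intro emeasure_bind) (auto simp: space_uniform_count_measure)
  also have "\<dots> = (\<Sum>i\<in>S. emeasure (N i) A) / of_nat (card S)"
    unfolding uniform_count_measure_def using S
    by (simp add: nn_integral_point_measure_finite c divide_ennreal_def sum_distrib_left mult.commute)
  finally show ?thesis .
qed

lemma sets_bind_uniform: "sets (uniform_count_measure S \<bind> N) = sets B"
  using S N by (intro sets_bind) (auto simp: space_uniform_count_measure space_prob_algebra)

lemma mixture_eq_bind: "mixture S N B = uniform_count_measure S \<bind> N"
proof -
  let ?M = "uniform_count_measure S \<bind> N"
  have "mixture S N B = measure_of (space B) (sets B) (emeasure ?M)"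
    unfolding mixture_def
    by (rule measure_of_eq) (auto simp: sets.space_closed sets.sigma_sets_eq emeasure_bind_uniform)
  also have "\<dots> = ?M"
    using measure_of_of_measure[of ?M] sets_bind_uniform sets_eq_imp_space_eq[OF sets_bind_uniform] by simp
  finally show ?thesis .
qed

lemma emeasure_mixture:
  "A \<in> sets B \<Longrightarrow> emeasure (mixture S N B) A = (\<Sum>i\<in>S. emeasure (N i) A) / of_nat (card S)"
  by (simp add: mixture_eq_bind emeasure_bind_uniform)

lemma mixture_prob: "mixture S N B \<in> space (prob_algebra B)"
proof -
  have "uniform_count_measure S \<in> space (prob_algebra (uniform_count_measure S))"
    using S by (simp add: space_prob_algebra prob_space_uniform_count_measure)
  from prob_space_bind'[OF this measurable_mixture_components] show ?thesis
    by (simp add: space_prob_algebra mixture_eq_bind sets_bind_uniform)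
qed

lemma
  fixes f :: "'x \<Rightarrow> real"
  assumes f[measurable]: "f \<in> borel_measurable B" and int: "\<And>i. i \<in> S \<Longrightarrow> integrable (N i) f"
  shows integral_mixture: "(\<integral>x. f x \<partial>mixture S N B) = (\<Sum>i\<in>S. \<integral>x. f x \<partial>N i) / real (card S)"
proof -
  let ?U = "uniform_count_measure S"
  note meas = measurable_prob_algebraD[OF measurable_mixture_components]
  have "(\<integral>\<^sup>+x. norm (f x) \<partial>(?U \<bind> N)) = (\<integral>\<^sup>+i. \<integral>\<^sup>+x. norm (f x) \<partial>N i \<partial>?U)"
    by (rule nn_integral_bind[OF _ meas]) simp
  also have "\<dots> = (\<Sum>i\<in>S. ennreal (1 / real (card S)) * (\<integral>\<^sup>+x. norm (f x) \<partial>N i))"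
    unfolding uniform_count_measure_def using S by (simp add: nn_integral_point_measure_finite)
  also have "\<dots> < \<infinity>"
    using int S by (auto simp: integrable_iff_bounded ennreal_mult_less_top)
  finally have "integrable (?U \<bind> N) f"
    using f by (auto simp: integrable_iff_bounded measurable_cong_sets[OF sets_bind_uniform refl])
  then have "(\<integral>x. f x \<partial>(?U \<bind> N)) = (\<integral>i. \<integral>x. f x \<partial>N i \<partial>?U)"
    using S by (intro integral_bind_kernel[OF meas]) (auto simp: space_uniform_count_measure)
  then show ?thesis
    using S by (simp add: mixture_eq_bind integral_uniform_count_measure)
qed

end

lemma measurable_mixture:
  assumes S: "finite S" "S \<noteq> {}" and N: "\<And>i. i \<in> S \<Longrightarrow> N i \<in> L \<rightarrow>\<^sub>M prob_algebra B"
  shows "(\<lambda>x. mixture S (\<lambda>i. N i x) B) \<in> L \<rightarrow>\<^sub>M prob_algebra B"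
proof (rule measurable_prob_algebraI)
  have N': "N i x \<in> space (prob_algebra B)" if "i \<in> S" "x \<in> space L" for i x
    using measurable_space[OF N[OF that(1)] that(2)] .
  note mix = mixture_prob[OF S, of "\<lambda>i. N i _", OF N']
  show "prob_space (mixture S (\<lambda>i. N i x) B)" if "x \<in> space L" for x
    using mix[OF _ that] by (simp add: space_prob_algebra)
  show "(\<lambda>x. mixture S (\<lambda>i. N i x) B) \<in> L \<rightarrow>\<^sub>M subprob_algebra B"
  proof (rule measurable_subprob_algebra)
    fix x assume x: "x \<in> space L"
    show "subprob_space (mixture S (\<lambda>i. N i x) B)" "sets (mixture S (\<lambda>i. N i x) B) = sets B"
      using mix[OF _ x] by (auto simp: space_prob_algebra prob_space_imp_subprob_space)
  next
    fix A assume A: "A \<in> sets B"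
    have "(\<lambda>x. (\<Sum>i\<in>S. emeasure (N i x) A) / of_nat (card S)) \<in> borel_measurable L"
      by (intro borel_measurable_divide_ennreal borel_measurable_sum borel_measurable_const
        measurable_compose[OF measurable_prob_algebraD[OF N] measurable_emeasure_subprob_algebra[OF A]])
    then show "(\<lambda>x. emeasure (mixture S (\<lambda>i. N i x) B) A) \<in> borel_measurable L"
      by (rule measurable_cong[THEN iffD1, rotated]) (simp add: emeasure_mixture[OF S N' A])
  qed
qed


section \<open>Updating a block of coordinates\<close>

locale gibbs =
  fixes n :: nat and X :: "nat \<Rightarrow> 'a topology" and P :: "(nat \<Rightarrow> 'a) measure"
    and \<kappa> :: "nat set \<Rightarrow> (nat \<Rightarrow> 'a) \<Rightarrow> (nat \<Rightarrow> 'a) measure"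
  assumes prob_P: "prob_space P"
    and sets_P[measurable_cong]: "sets P = sets (prod_space X {1..n})"
    and cond: "\<And>\<Lambda>. \<Lambda> \<subseteq> {1..n} \<Longrightarrow> 1 \<le> card \<Lambda> \<Longrightarrow> card \<Lambda> < n \<Longrightarrow> is_cond_distr n X P \<Lambda> (\<kappa> \<Lambda>)"
begin

declare One_nat_def [simp del]

sublocale prob_space P by (rule prob_P)

abbreviation "co \<Lambda> \<equiv> {1..n} - \<Lambda>"

definition block :: "nat set \<Rightarrow> bool" where
  "block \<Lambda> \<longleftrightarrow> \<Lambda> \<subseteq> {1..n} \<and> 1 \<le> card \<Lambda> \<and> card \<Lambda> < n"

definition update :: "nat set \<Rightarrow> (nat \<Rightarrow> 'a) \<Rightarrow> (nat \<Rightarrow> 'a) measure" where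
  "update \<Lambda> x = distr (\<kappa> \<Lambda> (restrict x (co \<Lambda>))) (prod_space X {1..n}) (\<lambda>z. merge \<Lambda> (co \<Lambda>) (z, x))"

abbreviation E :: "nat set \<Rightarrow> ((nat \<Rightarrow> 'a) \<Rightarrow> real) \<Rightarrow> (nat \<Rightarrow> 'a) \<Rightarrow> real" where
  "E \<Lambda> \<equiv> kernel_op (update \<Lambda>)"

lemma space_P: "space P = space (prod_space X {1..n})"
  by (rule sets_eq_imp_space_eq[OF sets_P])

lemma prob_algebra_P: "prob_algebra P = prob_algebra (prod_space X {1..n})"
  unfolding prob_algebra_def by (simp add: subprob_algebra_cong[OF sets_P])

lemma space_prod: "space (prod_space X \<Lambda>) = (\<Pi>\<^sub>E i\<in>\<Lambda>. space (borel_of (X i)))"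
  by (simp add: prod_space_def space_PiM)

lemma kappa_measurable: "block \<Lambda> \<Longrightarrow> \<kappa> \<Lambda> \<in> prod_space X (co \<Lambda>) \<rightarrow>\<^sub>M prob_algebra (prod_space X \<Lambda>)"
  using cond[of \<Lambda>] by (simp add: block_def is_cond_distr_def)

lemma restrict_measurable: "\<Gamma> \<subseteq> \<Lambda> \<Longrightarrow> (\<lambda>x. restrict x \<Gamma>) \<in> prod_space X \<Lambda> \<rightarrow>\<^sub>M prod_space X \<Gamma>"
  unfolding prod_space_def by (rule measurable_restrict_subset)

lemma restrict_measurable_P: "(\<lambda>x. restrict x (co \<Lambda>)) \<in> P \<rightarrow>\<^sub>M prod_space X (co \<Lambda>)"
  using restrict_measurable[of "co \<Lambda>" "{1..n}"] by (simp add: measurable_cong_sets[OF sets_P refl])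

text \<open>\<open>merge\<close> only looks at its second argument off the first index set, so the second argument may
  be a point of a larger product.\<close>

lemma merge_measurable:
  assumes "\<Gamma> \<subseteq> \<Lambda>"
  shows "merge \<Gamma> (\<Lambda> - \<Gamma>) \<in> prod_space X \<Gamma> \<Otimes>\<^sub>M prod_space X \<Lambda> \<rightarrow>\<^sub>M prod_space X \<Lambda>"
proof -
  have "(\<lambda>p. (fst p, restrict (snd p) (\<Lambda> - \<Gamma>))) \<in>
      prod_space X \<Gamma> \<Otimes>\<^sub>M prod_space X \<Lambda> \<rightarrow>\<^sub>M prod_space X \<Gamma> \<Otimes>\<^sub>M prod_space X (\<Lambda> - \<Gamma>)"
    by (intro measurable_Pair measurable_fst measurable_compose[OF measurable_snd restrict_measurable]) auto
  moreover have "merge \<Gamma> (\<Lambda> - \<Gamma>) \<in> prod_space X \<Gamma> \<Otimes>\<^sub>M prod_space X (\<Lambda> - \<Gamma>) \<rightarrow>\<^sub>M prod_space X \<Lambda>"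
  proof -
    have un: "\<Gamma> \<union> (\<Lambda> - \<Gamma>) = \<Lambda>" using assms by blast
    show ?thesis
      using measurable_merge[of \<Gamma> "\<Lambda> - \<Gamma>" "\<lambda>i. borel_of (X i)"]
      unfolding prod_space_def un .
  qed
  ultimately have "(\<lambda>p. merge \<Gamma> (\<Lambda> - \<Gamma>) (fst p, restrict (snd p) (\<Lambda> - \<Gamma>))) \<in>
      prod_space X \<Gamma> \<Otimes>\<^sub>M prod_space X \<Lambda> \<rightarrow>\<^sub>M prod_space X \<Lambda>"
    by (rule measurable_compose)
  then show ?thesis unfolding merge_restrict prod.collapse .
qed

lemma merge_measurable_fst:
  assumes "\<Gamma> \<subseteq> \<Lambda>" "u \<in> space (prod_space X \<Lambda>)"
  shows "(\<lambda>z. merge \<Gamma> (\<Lambda> - \<Gamma>) (z, u)) \<in> prod_space X \<Gamma> \<rightarrow>\<^sub>M prod_space X \<Lambda>"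
  by (rule measurable_compose[OF measurable_Pair2'[OF assms(2)] merge_measurable[OF assms(1)]])

lemma update_measurable:
  assumes "block \<Lambda>"
  shows "update \<Lambda> \<in> P \<rightarrow>\<^sub>M prob_algebra P"
  unfolding prob_algebra_P update_def[abs_def]
proof (rule measurable_distr_prob_space2)
  show "(\<lambda>x. \<kappa> \<Lambda> (restrict x (co \<Lambda>))) \<in> P \<rightarrow>\<^sub>M prob_algebra (prod_space X \<Lambda>)"
    by (rule measurable_compose[OF restrict_measurable_P kappa_measurable[OF assms]])
  have "\<Lambda> \<subseteq> {1..n}" using assms by (simp add: block_def)
  then have "(\<lambda>p. merge \<Lambda> (co \<Lambda>) (snd p, fst p)) \<in>
      prod_space X {1..n} \<Otimes>\<^sub>M prod_space X \<Lambda> \<rightarrow>\<^sub>M prod_space X {1..n}"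
    by (intro measurable_compose[OF _ merge_measurable] measurable_Pair measurable_fst measurable_snd)
  then show "(\<lambda>(x, z). merge \<Lambda> (co \<Lambda>) (z, x)) \<in> P \<Otimes>\<^sub>M prod_space X \<Lambda> \<rightarrow>\<^sub>M prod_space X {1..n}"
    by (simp add: case_prod_beta' measurable_cong_sets[OF sets_pair_measure_cong[OF sets_P refl] refl])
qed

lemma kappa_sets: "block \<Lambda> \<Longrightarrow> x \<in> space P \<Longrightarrow> sets (\<kappa> \<Lambda> (restrict x (co \<Lambda>))) = sets (prod_space X \<Lambda>)"
  and kappa_prob: "block \<Lambda> \<Longrightarrow> x \<in> space P \<Longrightarrow> prob_space (\<kappa> \<Lambda> (restrict x (co \<Lambda>)))"
  using measurable_space[OF measurable_compose[OF restrict_measurable_P kappa_measurable], of \<Lambda> x]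
  by (auto simp: space_prob_algebra)

lemma merge_kappa_measurable:
  assumes "block \<Lambda>" "x \<in> space P"
  shows "(\<lambda>z. merge \<Lambda> (co \<Lambda>) (z, x)) \<in> \<kappa> \<Lambda> (restrict x (co \<Lambda>)) \<rightarrow>\<^sub>M prod_space X {1..n}"
  using merge_measurable_fst[of \<Lambda> "{1..n}" x] assms
  by (simp add: block_def space_P measurable_cong_sets[OF kappa_sets[OF assms] refl])

lemma
  fixes f :: "(nat \<Rightarrow> 'a) \<Rightarrow> real"
  assumes "block \<Lambda>" "x \<in> space P" "f \<in> borel_measurable P"
  shows integral_update:
      "E \<Lambda> f x = (\<integral>z. f (merge \<Lambda> (co \<Lambda>) (z, x)) \<partial>\<kappa> \<Lambda> (restrict x (co \<Lambda>)))"
    and integrable_update: "integrable (update \<Lambda> x) f \<longleftrightarrow>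
      integrable (\<kappa> \<Lambda> (restrict x (co \<Lambda>))) (\<lambda>z. f (merge \<Lambda> (co \<Lambda>) (z, x)))"
proof -
  have f: "f \<in> borel_measurable (prod_space X {1..n})"
    using assms(3) by (simp add: measurable_cong_sets[OF sets_P refl])
  show "E \<Lambda> f x = (\<integral>z. f (merge \<Lambda> (co \<Lambda>) (z, x)) \<partial>\<kappa> \<Lambda> (restrict x (co \<Lambda>)))"
    unfolding kernel_op_def update_def by (rule integral_distr[OF merge_kappa_measurable[OF assms(1,2)] f])
  show "integrable (update \<Lambda> x) f \<longleftrightarrow>
      integrable (\<kappa> \<Lambda> (restrict x (co \<Lambda>))) (\<lambda>z. f (merge \<Lambda> (co \<Lambda>) (z, x)))"
    unfolding update_def by (rule integrable_distr_eq[OF merge_kappa_measurable[OF assms(1,2)] f])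
qed

text \<open>The defining identity of a conditional distribution, read on boxes. A box over all
  coordinates splits into one over \<Lambda> and one over its complement, and agreement on boxes
  determines a finite measure on the product.\<close>

lemma update_invariant:
  assumes b: "block \<Lambda>"
  shows "P \<bind> update \<Lambda> = P"
proof -
  let ?B = "\<lambda>i. borel_of (X i)" and ?r = "\<lambda>x. restrict x (co \<Lambda>)"
  have sub: "\<Lambda> \<subseteq> {1..n}" using b by (simp add: block_def)
  have un: "\<Lambda> \<union> co \<Lambda> = {1..n}" using sub by blast
  have setsB: "sets (P \<bind> update \<Lambda>) = sets P"
    using sets_bind'[OF _ update_measurable[OF b], of P] by (simp add: space_prob_algebra prob_P)
  show ?thesis
  proof (rule measure_eqI_PiM_finite[where I="{1..n}" and M="?B" and A="\<lambda>_. space (PiM {1..n} ?B)"])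
    fix A assume A: "\<And>i. i \<in> {1..n} \<Longrightarrow> A i \<in> sets (borel_of (X i))"
    let ?A = "\<lambda>I. Pi\<^sub>E I A"
    have mA: "?A I \<in> sets (prod_space X I)" if "I \<subseteq> {1..n}" for I
      unfolding prod_space_def using that A finite_subset[OF that] by (intro sets_PiM_I_finite) auto
    have split: "merge \<Lambda> (co \<Lambda>) (z, x) \<in> ?A {1..n} \<longleftrightarrow> z \<in> ?A \<Lambda> \<and> ?r x \<in> ?A (co \<Lambda>)"
      if "z \<in> extensional \<Lambda>" for z x :: "nat \<Rightarrow> 'a"
    proof -
      have "merge \<Lambda> (co \<Lambda>) (z, x) \<in> ?A {1..n} \<longleftrightarrow> z \<in> Pi \<Lambda> A \<and> x \<in> Pi (co \<Lambda>) A"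
        using PiE_cancel_merge[of \<Lambda> "co \<Lambda>" z x A] unfolding un by simp
      then show ?thesis
        using that by (simp add: restrict_PiE_iff PiE_iff Pi_iff)
    qed
    have "emeasure (P \<bind> update \<Lambda>) (?A {1..n}) = (\<integral>\<^sup>+x. emeasure (update \<Lambda> x) (?A {1..n}) \<partial>P)"
      using mA[of "{1..n}"]
      by (intro emeasure_bind[OF not_empty measurable_prob_algebraD[OF update_measurable[OF b]]])
        (simp add: sets_P)
    also have "\<dots> = (\<integral>\<^sup>+x. emeasure (\<kappa> \<Lambda> (?r x)) (?A \<Lambda>) * indicator (?A (co \<Lambda>)) (?r x) \<partial>P)"
    proof (rule nn_integral_cong)
      fix x assume x: "x \<in> space P"
      have sp: "space (\<kappa> \<Lambda> (?r x)) = space (prod_space X \<Lambda>)"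
        by (rule sets_eq_imp_space_eq[OF kappa_sets[OF b x]])
      have "emeasure (update \<Lambda> x) (?A {1..n}) =
          emeasure (\<kappa> \<Lambda> (?r x)) ((\<lambda>z. merge \<Lambda> (co \<Lambda>) (z, x)) -` ?A {1..n} \<inter> space (\<kappa> \<Lambda> (?r x)))"
        unfolding update_def by (rule emeasure_distr[OF merge_kappa_measurable[OF b x] mA]) simp
      also have "(\<lambda>z. merge \<Lambda> (co \<Lambda>) (z, x)) -` ?A {1..n} \<inter> space (\<kappa> \<Lambda> (?r x)) =
          (if ?r x \<in> ?A (co \<Lambda>) then ?A \<Lambda> else {})"
      proof -
        have "merge \<Lambda> (co \<Lambda>) (z, x) \<in> ?A {1..n} \<and> z \<in> space (prod_space X \<Lambda>) \<longleftrightarrow>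
            z \<in> ?A \<Lambda> \<and> ?r x \<in> ?A (co \<Lambda>)" for z
        proof (cases "z \<in> space (prod_space X \<Lambda>)")
          case True
          then have "z \<in> extensional \<Lambda>" by (simp add: space_prod PiE_def)
          from split[OF this] True show ?thesis by blast
        next
          case False
          then show ?thesis using sets.sets_into_space[OF mA[OF sub]] by blast
        qed
        then show ?thesis
          unfolding sp by (cases "?r x \<in> ?A (co \<Lambda>)")
            (simp_all only: set_eq_iff Int_iff vimage_eq if_True if_False empty_iff simp_thms)
      qed
      finally show "emeasure (update \<Lambda> x) (?A {1..n}) =
          emeasure (\<kappa> \<Lambda> (?r x)) (?A \<Lambda>) * indicator (?A (co \<Lambda>)) (?r x)"
        by (cases "?r x \<in> ?A (co \<Lambda>)") (simp_all only: if_True if_False indicator_simps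
          mult_1_right mult_zero_right emeasure_empty simp_thms)
    qed
    also have "\<dots> = (\<integral>\<^sup>+y\<in>?A (co \<Lambda>). emeasure (\<kappa> \<Lambda> y) (?A \<Lambda>) \<partial>marginal X P (co \<Lambda>))"
      unfolding marginal_def
    proof (rule nn_integral_distr[OF restrict_measurable_P, symmetric])
      have m: "(\<lambda>y. emeasure (\<kappa> \<Lambda> y) (?A \<Lambda>)) \<in> borel_measurable (prod_space X (co \<Lambda>))"
        using measurable_compose[OF measurable_prob_algebraD[OF kappa_measurable[OF b]]
          measurable_emeasure_subprob_algebra[OF mA[OF sub]]] .
      show "(\<lambda>y. emeasure (\<kappa> \<Lambda> y) (?A \<Lambda>) * indicator (?A (co \<Lambda>)) y) \<in>
          borel_measurable (distr P (prod_space X (co \<Lambda>)) ?r)"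
        unfolding measurable_cong_sets[OF sets_distr refl]
        by (rule borel_measurable_times_ennreal[OF m borel_measurable_indicator[OF mA[OF Diff_subset]]])
    qed
    also have "\<dots> = emeasure P {x \<in> space P. restrict x \<Lambda> \<in> ?A \<Lambda> \<and> ?r x \<in> ?A (co \<Lambda>)}"
    proof -
      have "\<forall>A\<in>sets (prod_space X \<Lambda>). \<forall>B\<in>sets (prod_space X (co \<Lambda>)).
          emeasure P {x \<in> space P. restrict x \<Lambda> \<in> A \<and> ?r x \<in> B} =
          (\<integral>\<^sup>+y\<in>B. emeasure (\<kappa> \<Lambda> y) A \<partial>marginal X P (co \<Lambda>))"
        using cond[of \<Lambda>] b unfolding is_cond_distr_def block_def by blast
      from this[THEN bspec, OF mA[OF sub], THEN bspec, OF mA[OF Diff_subset]] show ?thesis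
        by (rule sym)
    qed
    also have "{x \<in> space P. restrict x \<Lambda> \<in> ?A \<Lambda> \<and> ?r x \<in> ?A (co \<Lambda>)} = ?A {1..n}"
    proof -
      have Collect_eq: "{x \<in> S. Q x} = T" if "\<And>x. x \<in> S \<Longrightarrow> x \<in> T \<longleftrightarrow> Q x" "T \<subseteq> S"
        for S T :: "(nat \<Rightarrow> 'a) set" and Q
        using that by blast
      have "x \<in> ?A {1..n} \<longleftrightarrow> restrict x \<Lambda> \<in> ?A \<Lambda> \<and> ?r x \<in> ?A (co \<Lambda>)" if "x \<in> space P" for x
      proof -
        have m: "merge \<Lambda> (co \<Lambda>) (restrict x \<Lambda>, x) = x"
          using that by (simp add: Un_absorb1[OF sub] space_P space_prod PiE_iff extensional_restrict)
        show ?thesis by (rule split[OF restrict_extensional, of x x, unfolded m])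
      qed
      moreover have "?A {1..n} \<subseteq> space P"
        using sets.sets_into_space[OF mA[of "{1..n}"]] by (simp add: space_P)
      ultimately show ?thesis by (rule Collect_eq)
    qed
    finally show "emeasure (P \<bind> update \<Lambda>) (?A {1..n}) = emeasure P (?A {1..n})" .
  next
    show "range (\<lambda>_::nat. space (PiM {1..n} ?B)) \<subseteq> prod_algebra {1..n} ?B"
      by (auto simp: space_PiM intro!: prod_algebraI_finite)
    have "prob_space (P \<bind> update \<Lambda>)"
      by (rule prob_space_bind'[OF _ update_measurable[OF b]]) (simp add: space_prob_algebra prob_P)
    then show "emeasure (P \<bind> update \<Lambda>) (space (PiM {1..n} ?B)) \<noteq> \<infinity>"
      by (simp add: prob_space.finite_measure finite_measure.emeasure_finite)
  next
    show "sets P = sets (PiM {1..n} ?B)" "sets (P \<bind> update \<Lambda>) = sets (PiM {1..n} ?B)"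
      unfolding setsB by (rule sets_P[unfolded prod_space_def])+
    show "finite {1..n}" by simp
    show "(\<Union>i::nat. space (PiM {1..n} ?B)) = space (PiM {1..n} ?B)" by (simp only: UN_constant UNIV_not_empty if_False)
  qed
qed

lemma invariant_kernel_update: "block \<Lambda> \<Longrightarrow> invariant_kernel P (update \<Lambda>)"
  by (intro invariant_kernel.intro invariant_kernel_axioms.intro prob_P update_measurable update_invariant)


section \<open>Block updates as nested orthogonal projections\<close>

lemma E_L02: "block \<Lambda> \<Longrightarrow> f \<in> L02 P \<Longrightarrow> E \<Lambda> f \<in> L02 P"
  by (rule invariant_kernel.op_L02[OF invariant_kernel_update])

lemma E_measurable: "block \<Lambda> \<Longrightarrow> f \<in> borel_measurable P \<Longrightarrow> E \<Lambda> f \<in> borel_measurable P"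
  by (rule invariant_kernel.measurable_op[OF invariant_kernel_update])

lemma update_cong:
  assumes "restrict x (co \<Lambda>) = restrict x' (co \<Lambda>)"
  shows "update \<Lambda> x = update \<Lambda> x'"
proof -
  have "merge \<Lambda> (co \<Lambda>) (z, x) = merge \<Lambda> (co \<Lambda>) (z, x')" for z
    using merge_restrict(2)[of \<Lambda> "co \<Lambda>" z x] merge_restrict(2)[of \<Lambda> "co \<Lambda>" z x'] assms by metis
  then show ?thesis by (simp only: update_def assms)
qed

text \<open>Resampling \<Gamma> inside \<Lambda> leaves the coordinates off \<Lambda> untouched, and
  the law \<open>update \<Lambda> x\<close> depends on x only through those.\<close>

lemma E_merge:
  assumes "\<Gamma> \<subseteq> \<Lambda>"
  shows "E \<Lambda> f (merge \<Gamma> (co \<Gamma>) (z, x)) = E \<Lambda> f x"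
proof -
  have "restrict (merge \<Gamma> (co \<Gamma>) (z, x)) (co \<Lambda>) = restrict x (co \<Lambda>)"
    using assms by (auto simp: restrict_def merge_def fun_eq_iff)
  from update_cong[OF this] show ?thesis by (simp only: kernel_op_def)
qed

text \<open>\<open>E \<Lambda> f\<close> is constant along the points reached by updating \<Gamma>,
  so its mean under a probability measure is its value. The identity therefore holds at every point
  of the space.\<close>

lemma E_E:
  assumes "block \<Gamma>" "block \<Lambda>" "\<Gamma> \<subseteq> \<Lambda>" "f \<in> borel_measurable P" "x \<in> space P"
  shows "E \<Gamma> (E \<Lambda> f) x = E \<Lambda> f x"
proof -
  interpret k: prob_space "\<kappa> \<Gamma> (restrict x (co \<Gamma>))"
    by (rule kappa_prob[OF assms(1,5)])
  show ?thesis
    unfolding integral_update[OF assms(1,5) E_measurable[OF assms(2,4)]] E_merge[OF assms(3)]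
    by (simp only: lebesgue_integral_const k.prob_space scaleR_one)
qed

text \<open>Invariance allows \<open>E \<Lambda>\<close> to be inserted under the integral, and the
  factor \<open>E \<Lambda> f\<close>, constant on fibres, comes out of it. The right side is
  symmetric in f and g, which gives self-adjointness.\<close>

lemma E_inner:
  assumes b: "block \<Lambda>" and f: "f \<in> L02 P" and g: "g \<in> L02 P"
  shows "L2_inner P (E \<Lambda> f) g = L2_inner P (E \<Lambda> f) (E \<Lambda> g)"
proof -
  interpret K: invariant_kernel P "update \<Lambda>" by (rule invariant_kernel_update[OF b])
  note Ef = K.op_L02[OF f]
  have "L2_inner P (E \<Lambda> f) g = (\<integral>x. E \<Lambda> (\<lambda>x. E \<Lambda> f x * g x) x \<partial>P)"
    unfolding L2_inner_def by (rule K.integral_op[symmetric]) (rule L02_mult[OF Ef g])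
  also have "\<dots> = (\<integral>x. E \<Lambda> f x * E \<Lambda> g x \<partial>P)"
  proof (rule Bochner_Integration.integral_cong[OF refl])
    fix x assume x: "x \<in> space P"
    have m: "(\<lambda>x. E \<Lambda> f x * g x) \<in> borel_measurable P"
      by (intro borel_measurable_times L02_measurable Ef g)
    show "E \<Lambda> (\<lambda>x. E \<Lambda> f x * g x) x = E \<Lambda> f x * E \<Lambda> g x"
      unfolding integral_update[OF b x m] integral_update[OF b x L02_measurable[OF g]]
        E_merge[OF subset_refl] by simp
  qed
  finally show ?thesis by (simp add: L2_inner_def)
qed

lemma E_self_adjoint:
  assumes "block \<Lambda>" "f \<in> L02 P" "g \<in> L02 P"
  shows "L2_inner P (E \<Lambda> f) g = L2_inner P f (E \<Lambda> g)"
  using E_inner[OF assms] E_inner[OF assms(1,3,2)] by (simp add: L2_inner_commute)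

text \<open>Self-adjointness moves \<open>E \<Gamma>\<close> onto \<open>E \<Lambda> f\<close>,
  which it fixes.\<close>

lemma E_inner_nested:
  assumes b: "block \<Gamma>" "block \<Lambda>" and sub: "\<Gamma> \<subseteq> \<Lambda>" and f: "f \<in> L02 P" and g: "g \<in> L02 P"
  shows "L2_inner P (E \<Lambda> f) (E \<Gamma> g) = L2_inner P (E \<Lambda> f) g"
proof -
  have "L2_inner P (E \<Lambda> f) (E \<Gamma> g) = L2_inner P (E \<Gamma> (E \<Lambda> f)) g"
    using b f g by (simp add: E_self_adjoint E_L02)
  also have "\<dots> = L2_inner P (E \<Lambda> f) g"
    unfolding L2_inner_def
    by (rule Bochner_Integration.integral_cong[OF refl]) (simp add: E_E[OF b sub L02_measurable[OF f]])
  finally show ?thesis .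
qed

lemma E_form_nonneg:
  assumes "block \<Lambda>" "f \<in> L02 P"
  shows "0 \<le> L2_inner P f (E \<Lambda> f)"
  using E_inner[OF assms assms(2)] L2_inner_nonneg[of "E \<Lambda> f"] by (simp add: L2_inner_commute)

text \<open>Both forms are squared norms of projections, say a and b, and the inner product of the
  two projections is a by nesting. Cauchy-Schwarz reads a^2 \<le> a b.\<close>

lemma E_form_antimono:
  assumes b: "block \<Gamma>" "block \<Lambda>" and sub: "\<Gamma> \<subseteq> \<Lambda>" and f: "f \<in> L02 P"
  shows "L2_inner P f (E \<Lambda> f) \<le> L2_inner P f (E \<Gamma> f)"
proof -
  let ?a = "L2_inner P f (E \<Lambda> f)" and ?b = "L2_inner P f (E \<Gamma> f)"
  have a: "L2_inner P (E \<Lambda> f) (E \<Lambda> f) = ?a" "L2_inner P (E \<Gamma> f) (E \<Gamma> f) = ?b"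
    using E_inner[OF b(2) f f] E_inner[OF b(1) f f] by (simp_all add: L2_inner_commute)
  have "L2_inner P (E \<Lambda> f) (E \<Gamma> f) = ?a"
    using E_inner_nested[OF b sub f f] by (simp add: L2_inner_commute)
  then have "?a * ?a \<le> ?a * ?b"
    using L2_Cauchy_Schwarz[OF E_L02[OF b(2) f] E_L02[OF b(1) f]] a by (simp add: power2_eq_square)
  then show ?thesis
    using E_form_nonneg[OF b(1) f] E_form_nonneg[OF b(2) f] by (cases "?a = 0") auto
qed

section \<open>The random-scan kernel as an average of block updates\<close>

definition blocks :: "nat \<Rightarrow> nat set set" where
  "blocks r = {\<Lambda>. \<Lambda> \<subseteq> {1..n} \<and> card \<Lambda> = r}"

abbreviation T :: "nat \<Rightarrow> (nat \<Rightarrow> 'a) \<Rightarrow> (nat \<Rightarrow> 'a) measure" where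
  "T \<equiv> gibbs_kernel n X \<kappa>"

lemma finite_blocks: "finite (blocks r)"
  by (rule finite_subset[of _ "Pow {1..n}"]) (auto simp: blocks_def)

lemma card_blocks: "card (blocks r) = n choose r"
  unfolding blocks_def using n_subsets[of "{1..n}" r] by simp

context
  fixes r assumes r: "1 \<le> r" "r < n"
begin

lemma block_blocks: "\<Lambda> \<in> blocks r \<Longrightarrow> block \<Lambda>"
  using r by (simp add: blocks_def block_def)

lemma blocks_nonempty: "blocks r \<noteq> {}"
  using card_blocks[of r] r by auto

lemma T_eq_mixture: "T r x = mixture (blocks r) (\<lambda>\<Lambda>. update \<Lambda> x) (prod_space X {1..n})"
  unfolding gibbs_kernel_def mixture_def card_blocks[symmetric] update_def blocks_def ..

lemma T_measurable: "T r \<in> P \<rightarrow>\<^sub>M prob_algebra P"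
  unfolding T_eq_mixture[abs_def] prob_algebra_P
  by (rule measurable_mixture[OF finite_blocks blocks_nonempty])
    (rule update_measurable[unfolded prob_algebra_P, OF block_blocks])

lemma update_in_prob_algebra:
  "x \<in> space P \<Longrightarrow> \<Lambda> \<in> blocks r \<Longrightarrow> update \<Lambda> x \<in> space (prob_algebra (prod_space X {1..n}))"
  using measurable_space[OF update_measurable[OF block_blocks]] by (simp add: prob_algebra_P)

lemma T_invariant: "P \<bind> T r = P"
proof (rule measure_eqI)
  show sets: "sets (P \<bind> T r) = sets P"
    using sets_bind'[OF _ T_measurable, of P] by (simp add: space_prob_algebra prob_P)
  fix A assume "A \<in> sets (P \<bind> T r)"
  then have A: "A \<in> sets P" by (simp only: sets)
  have c: "0 < card (blocks r)"
    using finite_blocks blocks_nonempty by (simp add: card_gt_0_iff)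
  have m: "(\<lambda>x. emeasure (update \<Lambda> x) A) \<in> borel_measurable P" if "\<Lambda> \<in> blocks r" for \<Lambda>
    using measurable_compose[OF measurable_prob_algebraD[OF update_measurable[OF block_blocks[OF that]]]
      measurable_emeasure_subprob_algebra[OF A]] .
  have "emeasure (P \<bind> T r) A = (\<integral>\<^sup>+x. emeasure (T r x) A \<partial>P)"
    by (rule emeasure_bind[OF not_empty measurable_prob_algebraD[OF T_measurable] A])
  also have "\<dots> = (\<integral>\<^sup>+x. (\<Sum>\<Lambda>\<in>blocks r. emeasure (update \<Lambda> x) A) / of_nat (card (blocks r)) \<partial>P)"
    unfolding T_eq_mixture using A sets_P
    by (intro nn_integral_cong emeasure_mixture[OF finite_blocks blocks_nonempty update_in_prob_algebra]) auto
  also have "\<dots> = (\<Sum>\<Lambda>\<in>blocks r. (\<integral>\<^sup>+x. emeasure (update \<Lambda> x) A \<partial>P)) / of_nat (card (blocks r))"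
    using m by (simp add: nn_integral_divide nn_integral_sum)
  also have "\<dots> = (\<Sum>\<Lambda>\<in>blocks r. emeasure P A) / of_nat (card (blocks r))"
  proof -
    have "(\<integral>\<^sup>+x. emeasure (update \<Lambda> x) A \<partial>P) = emeasure P A" if "\<Lambda> \<in> blocks r" for \<Lambda>
      using emeasure_bind[OF not_empty measurable_prob_algebraD[OF update_measurable[OF block_blocks[OF that]]] A]
        update_invariant[OF block_blocks[OF that]] by simp
    then show ?thesis by simp
  qed
  also have "\<dots> = emeasure P A"
    using c by (simp add: ennreal_divide_eq_top_iff mult_divide_eq_ennreal mult.commute[of "of_nat _"])
  finally show "emeasure (P \<bind> T r) A = emeasure P A" .
qed

lemma invariant_kernel_T: "invariant_kernel P (T r)"
  by (intro invariant_kernel.intro invariant_kernel_axioms.intro prob_P T_measurable T_invariant)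

text \<open>The integral splits over the mixture where f is integrable under every component, which
  invariance of each update guarantees for almost every x.\<close>

lemma T_op_AE:
  assumes f: "f \<in> L02 P"
  shows "AE x in P. kernel_op (T r) f x = (\<Sum>\<Lambda>\<in>blocks r. E \<Lambda> f x) / (n choose r)"
proof -
  have "AE x in P. \<forall>\<Lambda>\<in>blocks r. integrable (update \<Lambda> x) f"
    using finite_blocks by (intro AE_finite_allI)
      (auto intro: invariant_kernel.AE_integrable_K[OF invariant_kernel_update[OF block_blocks]] L02_integrable[OF f])
  then show ?thesis
    using AE_space
  proof eventually_elim
    case (elim x)
    have "f \<in> borel_measurable (prod_space X {1..n})"
      using L02_measurable[OF f] by (simp add: measurable_cong_sets[OF sets_P refl])
    from integral_mixture[OF finite_blocks blocks_nonempty update_in_prob_algebra[OF elim(2)] this] elim(1)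
    show ?case by (simp add: kernel_op_def T_eq_mixture card_blocks)
  qed
qed

lemma avg_L02: "f \<in> L02 P \<Longrightarrow> (\<lambda>x. (\<Sum>\<Lambda>\<in>blocks r. E \<Lambda> f x) / c) \<in> L02 P"
  using L02_scale[OF L02_sum[OF finite_blocks], of r "\<lambda>\<Lambda>. E \<Lambda> f" "inverse c"] E_L02 block_blocks
  by (simp add: divide_inverse mult.commute)

lemma T_inner:
  assumes f: "f \<in> L02 P" and g: "g \<in> L02 P"
  shows "L2_inner P (kernel_op (T r) f) g = (\<Sum>\<Lambda>\<in>blocks r. L2_inner P (E \<Lambda> f) g) / (n choose r)"
proof -
  interpret K: invariant_kernel P "T r" by (rule invariant_kernel_T)
  have "L2_inner P (kernel_op (T r) f) g = L2_inner P (\<lambda>x. (\<Sum>\<Lambda>\<in>blocks r. E \<Lambda> f x) / (n choose r)) g"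
    by (rule L2_inner_cong_AE[OF _ _ _ T_op_AE[OF f]]) (intro L02_measurable K.op_L02 avg_L02 f g)+
  also have "\<dots> = inverse (n choose r) * L2_inner P (\<lambda>x. \<Sum>\<Lambda>\<in>blocks r. E \<Lambda> f x) g"
    by (subst L2_inner_scale[symmetric]) (simp add: divide_inverse mult.commute)
  also have "L2_inner P (\<lambda>x. \<Sum>\<Lambda>\<in>blocks r. E \<Lambda> f x) g = (\<Sum>\<Lambda>\<in>blocks r. L2_inner P (E \<Lambda> f) g)"
    by (rule L2_inner_sum[OF finite_blocks E_L02[OF block_blocks f] g])
  finally show ?thesis by (simp add: divide_inverse mult.commute)
qed

lemma T_form:
  "f \<in> L02 P \<Longrightarrow> L2_inner P f (kernel_op (T r) f) = (\<Sum>\<Lambda>\<in>blocks r. L2_inner P f (E \<Lambda> f)) / (n choose r)"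
  using T_inner[of f f] by (simp add: L2_inner_commute[of f])

lemma positive_kernel_T: "positive_kernel P (T r)"
proof (intro positive_kernel.intro positive_kernel_axioms.intro invariant_kernel_T)
  fix f g assume fg: "f \<in> L02 P" "g \<in> L02 P"
  have "(\<Sum>\<Lambda>\<in>blocks r. L2_inner P (E \<Lambda> f) g) = (\<Sum>\<Lambda>\<in>blocks r. L2_inner P (E \<Lambda> g) f)"
    by (rule sum.cong[OF refl]) (metis E_self_adjoint L2_inner_commute block_blocks fg)
  then show "L2_inner P (kernel_op (T r) f) g = L2_inner P f (kernel_op (T r) g)"
    using T_inner[OF fg] T_inner[OF fg(2,1)] by (simp add: L2_inner_commute[of f])
next
  fix f assume "f \<in> L02 P"
  then show "0 \<le> L2_inner P f (kernel_op (T r) f)"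
    by (auto simp: T_form intro!: divide_nonneg_nonneg sum_nonneg E_form_nonneg block_blocks)
qed

end

text \<open>A uniform \<open>m\<close>-subset of a uniform \<open>l\<close>-subset is a uniform \<open>m\<close>-subset.\<close>

lemma average_blocks:
  fixes e :: "nat set \<Rightarrow> real"
  assumes "m \<le> l" "l \<le> n"
  shows "(\<Sum>\<Lambda>\<in>blocks l. (\<Sum>\<Gamma> | \<Gamma> \<subseteq> \<Lambda> \<and> card \<Gamma> = m. e \<Gamma>) / (l choose m)) / (n choose l) =
    (\<Sum>\<Gamma>\<in>blocks m. e \<Gamma>) / (n choose m)"
proof -
  \<comment> \<open>Double counting: after exchanging the sums each \<Gamma> is weighted by the
    number of l-sets above it. Removing \<Gamma> shows that this number does not depend on
    \<Gamma>.\<close>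
  have card: "card {\<Lambda> \<in> blocks l. \<Gamma> \<subseteq> \<Lambda>} = (n - m) choose (l - m)" if "\<Gamma> \<in> blocks m" for \<Gamma>
  proof -
    have \<Gamma>: "\<Gamma> \<subseteq> {1..n}" "card \<Gamma> = m" "finite \<Gamma>"
      using that finite_subset[of \<Gamma> "{1..n}"] by (auto simp: blocks_def)
    have "bij_betw (\<lambda>D. \<Gamma> \<union> D) {D. D \<subseteq> co \<Gamma> \<and> card D = l - m} {\<Lambda> \<in> blocks l. \<Gamma> \<subseteq> \<Lambda>}"
    proof (rule bij_betw_byWitness[where f'="\<lambda>\<Lambda>. \<Lambda> - \<Gamma>"])
      show "(\<lambda>D. \<Gamma> \<union> D) ` {D. D \<subseteq> co \<Gamma> \<and> card D = l - m} \<subseteq> {\<Lambda> \<in> blocks l. \<Gamma> \<subseteq> \<Lambda>}"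
      proof safe
        fix D assume D: "D \<subseteq> co \<Gamma>" "card D = l - m"
        then have "finite D" using finite_subset[of D "co \<Gamma>"] by simp
        then have "card (\<Gamma> \<union> D) = l"
          using D \<Gamma> assms by (subst card_Un_disjoint) auto
        then show "\<Gamma> \<union> D \<in> blocks l" using D \<Gamma> by (auto simp: blocks_def)
      qed
      show "(\<lambda>\<Lambda>. \<Lambda> - \<Gamma>) ` {\<Lambda> \<in> blocks l. \<Gamma> \<subseteq> \<Lambda>} \<subseteq> {D. D \<subseteq> co \<Gamma> \<and> card D = l - m}"
        using \<Gamma> by (auto simp: blocks_def card_Diff_subset)
    qed auto
    then have "card {\<Lambda> \<in> blocks l. \<Gamma> \<subseteq> \<Lambda>} = card {D. D \<subseteq> co \<Gamma> \<and> card D = l - m}"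
      by (rule bij_betw_same_card[symmetric])
    also have "\<dots> = card (co \<Gamma>) choose (l - m)"
      by (rule n_subsets) simp
    also have "card (co \<Gamma>) = n - m"
      using \<Gamma> by (simp add: card_Diff_subset)
    finally show ?thesis .
  qed
  have sub: "{\<Gamma>. \<Gamma> \<subseteq> \<Lambda> \<and> card \<Gamma> = m} = {\<Gamma> \<in> blocks m. \<Gamma> \<subseteq> \<Lambda>}" if "\<Lambda> \<in> blocks l" for \<Lambda>
    using that by (auto simp: blocks_def)
  have "(\<Sum>\<Lambda>\<in>blocks l. \<Sum>\<Gamma> | \<Gamma> \<subseteq> \<Lambda> \<and> card \<Gamma> = m. e \<Gamma>) = (\<Sum>\<Lambda>\<in>blocks l. \<Sum>\<Gamma> | \<Gamma> \<in> blocks m \<and> \<Gamma> \<subseteq> \<Lambda>. e \<Gamma>)"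
    using sub by (intro sum.cong) auto
  also have "\<dots> = (\<Sum>\<Gamma>\<in>blocks m. \<Sum>\<Lambda> | \<Lambda> \<in> blocks l \<and> \<Gamma> \<subseteq> \<Lambda>. e \<Gamma>)"
    by (rule sum.swap_restrict[OF finite_blocks finite_blocks])
  also have "\<dots> = ((n - m) choose (l - m)) * (\<Sum>\<Gamma>\<in>blocks m. e \<Gamma>)"
    by (simp add: card sum_distrib_left)
  finally have "(\<Sum>\<Lambda>\<in>blocks l. \<Sum>\<Gamma> | \<Gamma> \<subseteq> \<Lambda> \<and> card \<Gamma> = m. e \<Gamma>) =
      real ((n - m) choose (l - m)) * (\<Sum>\<Gamma>\<in>blocks m. e \<Gamma>)" .
  moreover have "real (n choose l) * real (l choose m) = real (n choose m) * real ((n - m) choose (l - m))"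
    using choose_mult[OF assms] by (simp flip: of_nat_mult)
  moreover have "0 < real (n choose l)" "0 < real (l choose m)" "0 < real (n choose m)"
    using assms by auto
  ultimately show ?thesis
    by (simp add: sum_divide_distrib[symmetric] field_simps)
qed

lemma T_form_antimono:
  assumes lm: "1 \<le> m" "m < l" "l < n" and f: "f \<in> L02 P"
  shows "L2_inner P f (kernel_op (T l) f) \<le> L2_inner P f (kernel_op (T m) f)"
proof -
  let ?S = "\<lambda>\<Lambda>. {\<Gamma>. \<Gamma> \<subseteq> \<Lambda> \<and> card \<Gamma> = m}"
  have "L2_inner P f (E \<Lambda> f) \<le> (\<Sum>\<Gamma>\<in>?S \<Lambda>. L2_inner P f (E \<Gamma> f)) / (l choose m)"
    if \<Lambda>: "\<Lambda> \<in> blocks l" for \<Lambda>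
  proof -
    have fin: "finite \<Lambda>" "card \<Lambda> = l" using \<Lambda> finite_subset[of \<Lambda> "{1..n}"] by (auto simp: blocks_def)
    have "(\<Sum>\<Gamma>\<in>?S \<Lambda>. L2_inner P f (E \<Lambda> f)) \<le> (\<Sum>\<Gamma>\<in>?S \<Lambda>. L2_inner P f (E \<Gamma> f))"
      using lm f \<Lambda> by (intro sum_mono E_form_antimono) (auto simp: blocks_def block_def)
    then have "(l choose m) * L2_inner P f (E \<Lambda> f) \<le> (\<Sum>\<Gamma>\<in>?S \<Lambda>. L2_inner P f (E \<Gamma> f))"
      using n_subsets[OF fin(1), of m] by (simp add: fin(2))
    then show ?thesis using lm by (simp add: pos_le_divide_eq mult.commute)
  qed
  then have "(\<Sum>\<Lambda>\<in>blocks l. L2_inner P f (E \<Lambda> f)) / (n choose l) \<le>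
      (\<Sum>\<Lambda>\<in>blocks l. (\<Sum>\<Gamma>\<in>?S \<Lambda>. L2_inner P f (E \<Gamma> f)) / (l choose m)) / (n choose l)"
    by (intro divide_right_mono sum_mono) auto
  then show ?thesis
    using lm f by (simp add: average_blocks T_form)
qed


section \<open>The conditional kernel on a fibre\<close>

lemma merge_merge:
  assumes "\<Gamma> \<subseteq> \<Lambda>" "\<Lambda> \<subseteq> {1..n}"
  shows "merge \<Lambda> (co \<Lambda>) (merge \<Gamma> (\<Lambda> - \<Gamma>) (z, u), x) = merge \<Gamma> (co \<Gamma>) (z, merge \<Lambda> (co \<Lambda>) (u, x))"
  using assms by (auto simp: merge_def fun_eq_iff)

text \<open>One component of \<open>cond_gibbs_kernel\<close>, its frozen state taken from a full
  point x. By \<open>merge_merge\<close>, mapping it into the full product by refilling the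
  coordinates off \<Lambda> gives \<open>update \<Gamma>\<close> at the refilled point, so fibre
  integrals become values of \<open>E \<Gamma>\<close>.\<close>

definition local_update :: "nat set \<Rightarrow> (nat \<Rightarrow> 'a) \<Rightarrow> nat set \<Rightarrow> (nat \<Rightarrow> 'a) \<Rightarrow> (nat \<Rightarrow> 'a) measure" where
  "local_update \<Lambda> x \<Gamma> u = distr (\<kappa> \<Gamma> (restrict (merge \<Lambda> (co \<Lambda>) (u, x)) (co \<Gamma>))) (prod_space X \<Lambda>)
     (\<lambda>z. merge \<Gamma> (\<Lambda> - \<Gamma>) (z, u))"

context
  fixes \<Lambda> l m x
  assumes lm: "1 \<le> m" "m < l" "l < n" and \<Lambda>: "\<Lambda> \<in> blocks l" and x: "x \<in> space P"
begin

abbreviation (input) "lift u \<equiv> merge \<Lambda> (co \<Lambda>) (u, x)"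
abbreviation (input) "subblocks \<equiv> {\<Gamma>. \<Gamma> \<subseteq> \<Lambda> \<and> card \<Gamma> = m}"

lemma block_facts: "\<Lambda> \<subseteq> {1..n}" "card \<Lambda> = l" "finite \<Lambda>" "block \<Lambda>"
  using \<Lambda> lm finite_subset[of \<Lambda> "{1..n}"] by (auto simp: blocks_def block_def)

lemma subblocks: "finite subblocks" "subblocks \<noteq> {}" "card subblocks = l choose m"
  "\<Gamma> \<in> subblocks \<Longrightarrow> block \<Gamma> \<and> \<Gamma> \<subseteq> \<Lambda>"
proof -
  show fin: "finite subblocks"
    by (rule finite_subset[of _ "Pow \<Lambda>"]) (use block_facts in auto)
  show card: "card subblocks = l choose m"
    using n_subsets[OF block_facts(3), of m] block_facts(2) by simp
  have "0 < card subblocks" unfolding card using lm by simp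
  then show "subblocks \<noteq> {}" by force
  show "\<Gamma> \<in> subblocks \<Longrightarrow> block \<Gamma> \<and> \<Gamma> \<subseteq> \<Lambda>"
    using lm block_facts by (auto simp: block_def)
qed

lemma lift_measurable: "(\<lambda>u. lift u) \<in> prod_space X \<Lambda> \<rightarrow>\<^sub>M P"
  using merge_measurable_fst[OF block_facts(1), of x] x
  by (simp add: space_P measurable_cong_sets[OF refl sets_P])

lemma local_update_measurable:
  assumes \<Gamma>: "\<Gamma> \<in> subblocks"
  shows "local_update \<Lambda> x \<Gamma> \<in> prod_space X \<Lambda> \<rightarrow>\<^sub>M prob_algebra (prod_space X \<Lambda>)"
  unfolding local_update_def[abs_def]
proof (rule measurable_distr_prob_space2)
  have b: "block \<Gamma>" "\<Gamma> \<subseteq> \<Lambda>" using subblocks(4)[OF \<Gamma>] by auto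
  show "(\<lambda>u. \<kappa> \<Gamma> (restrict (lift u) (co \<Gamma>))) \<in> prod_space X \<Lambda> \<rightarrow>\<^sub>M prob_algebra (prod_space X \<Gamma>)"
    by (rule measurable_compose[OF measurable_compose[OF lift_measurable restrict_measurable_P]
      kappa_measurable[OF b(1)]])
  have "(\<lambda>p. merge \<Gamma> (\<Lambda> - \<Gamma>) (snd p, fst p)) \<in>
      prod_space X \<Lambda> \<Otimes>\<^sub>M prod_space X \<Gamma> \<rightarrow>\<^sub>M prod_space X \<Lambda>"
    by (intro measurable_compose[OF _ merge_measurable] measurable_Pair measurable_fst measurable_snd b)
  then show "(\<lambda>(u, z). merge \<Gamma> (\<Lambda> - \<Gamma>) (z, u)) \<in> prod_space X \<Lambda> \<Otimes>\<^sub>M prod_space X \<Gamma> \<rightarrow>\<^sub>M prod_space X \<Lambda>"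
    by (simp add: case_prod_beta')
qed

lemma local_update_prob: "\<lbrakk>\<Gamma> \<in> subblocks; u \<in> space (prod_space X \<Lambda>)\<rbrakk> \<Longrightarrow>
    local_update \<Lambda> x \<Gamma> u \<in> space (prob_algebra (prod_space X \<Lambda>))"
  by (rule measurable_space[OF local_update_measurable])

lemma cond_gibbs_eq_mixture:
  "cond_gibbs_kernel n X \<kappa> m \<Lambda> (restrict x (co \<Lambda>)) u =
    mixture subblocks (\<lambda>\<Gamma>. local_update \<Lambda> x \<Gamma> u) (prod_space X \<Lambda>)"
proof -
  have "merge \<Lambda> (co \<Lambda>) (u, restrict x (co \<Lambda>)) = lift u" by simp
  then show ?thesis
    by (simp only: cond_gibbs_kernel_def mixture_def local_update_def subblocks(3) block_facts(2))
qed

lemma cond_gibbs_measurable: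
  "cond_gibbs_kernel n X \<kappa> m \<Lambda> (restrict x (co \<Lambda>)) \<in> prod_space X \<Lambda> \<rightarrow>\<^sub>M prob_algebra (prod_space X \<Lambda>)"
  unfolding cond_gibbs_eq_mixture[abs_def]
  by (rule measurable_mixture[OF subblocks(1,2) local_update_measurable])

text \<open>The constant c will be the fibre mean of f; it is the same for every \<Gamma>, so the
  centred restriction stays centred by the same amount after averaging over \<Gamma>.\<close>

lemma local_update_integral:
  fixes f :: "(nat \<Rightarrow> 'a) \<Rightarrow> real"
  assumes \<Gamma>: "\<Gamma> \<in> subblocks" and u: "u \<in> space (prod_space X \<Lambda>)"
    and f: "f \<in> borel_measurable P" and int: "integrable (update \<Gamma> (lift u)) f"
  shows "integrable (local_update \<Lambda> x \<Gamma> u) (\<lambda>u'. f (lift u') - c)" (is ?I)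
    and "(\<integral>u'. f (lift u') - c \<partial>local_update \<Lambda> x \<Gamma> u) = E \<Gamma> f (lift u) - c" (is ?E)
proof -
  have b: "block \<Gamma>" "\<Gamma> \<subseteq> \<Lambda>" using subblocks(4)[OF \<Gamma>] by auto
  have lu: "lift u \<in> space P" by (rule measurable_space[OF lift_measurable u])
  let ?k = "\<kappa> \<Gamma> (restrict (lift u) (co \<Gamma>))"
  interpret k: prob_space ?k by (rule kappa_prob[OF b(1) lu])
  have mm: "(\<lambda>z. merge \<Gamma> (\<Lambda> - \<Gamma>) (z, u)) \<in> ?k \<rightarrow>\<^sub>M prod_space X \<Lambda>"
    using merge_measurable_fst[OF b(2) u]
    by (simp only: measurable_cong_sets[OF kappa_sets[OF b(1) lu] refl])
  have hm: "(\<lambda>u'. f (lift u') - c) \<in> borel_measurable (prod_space X \<Lambda>)"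
    by (intro borel_measurable_diff measurable_compose[OF lift_measurable f] borel_measurable_const)
  have int': "integrable ?k (\<lambda>z. f (merge \<Gamma> (co \<Gamma>) (z, lift u)))"
    using int unfolding integrable_update[OF b(1) lu f] .
  note mrg = merge_merge[OF b(2) block_facts(1)]
  show ?I
    unfolding local_update_def integrable_distr_eq[OF mm hm] mrg using int' by simp
  show ?E
    unfolding local_update_def integral_distr[OF mm hm] mrg integral_update[OF b(1) lu f]
    using int' by (simp add: k.prob_space)
qed

lemma cond_gibbs_op:
  fixes f :: "(nat \<Rightarrow> 'a) \<Rightarrow> real"
  assumes u: "u \<in> space (prod_space X \<Lambda>)" and f: "f \<in> borel_measurable P"
    and int: "\<And>\<Gamma>. \<Gamma> \<in> subblocks \<Longrightarrow> integrable (update \<Gamma> (lift u)) f"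
  shows "kernel_op (cond_gibbs_kernel n X \<kappa> m \<Lambda> (restrict x (co \<Lambda>))) (\<lambda>u'. f (lift u') - c) u =
    (\<Sum>\<Gamma>\<in>subblocks. E \<Gamma> f (lift u)) / (l choose m) - c"
proof -
  have hm: "(\<lambda>u'. f (lift u') - c) \<in> borel_measurable (prod_space X \<Lambda>)"
    by (intro borel_measurable_diff measurable_compose[OF lift_measurable f] borel_measurable_const)
  have "kernel_op (cond_gibbs_kernel n X \<kappa> m \<Lambda> (restrict x (co \<Lambda>))) (\<lambda>u'. f (lift u') - c) u =
      (\<Sum>\<Gamma>\<in>subblocks. \<integral>u'. f (lift u') - c \<partial>local_update \<Lambda> x \<Gamma> u) / card subblocks"
    unfolding kernel_op_def cond_gibbs_eq_mixture
    by (rule integral_mixture[OF subblocks(1,2) local_update_prob[OF _ u] hm local_update_integral(1)[OF _ u f int]])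
  also have "\<dots> = (\<Sum>\<Gamma>\<in>subblocks. E \<Gamma> f (lift u) - c) / (l choose m)"
    unfolding subblocks(3) using local_update_integral(2)[OF _ u f int] by simp
  also have "\<dots> = (\<Sum>\<Gamma>\<in>subblocks. E \<Gamma> f (lift u)) / (l choose m) - c"
    using lm by (simp only: sum_subtractf sum_constant subblocks(3)) (simp add: diff_divide_distrib)
  finally show ?thesis .
qed

text \<open>The gap hypothesis on the fibre through \<open>x\<close>, tested on the restriction of \<open>f\<close> centred at its
  fibre mean \<open>E \<Lambda> f x\<close>. As \<open>E \<Lambda> f\<close> is constant on the fibre, both sides are \<open>update \<Lambda> x\<close>-integrals of
  functions that do not depend on \<open>x\<close>.\<close>

lemma fibre_gap:
  fixes f :: "(nat \<Rightarrow> 'a) \<Rightarrow> real"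
  assumes f: "f \<in> borel_measurable P" and sq: "integrable (update \<Lambda> x) (\<lambda>x. (f x)\<^sup>2)"
    and int: "AE x' in update \<Lambda> x. \<forall>\<Gamma>\<in>subblocks. integrable (update \<Gamma> x') f"
    and gap: "\<forall>g\<in>L02 (\<kappa> \<Lambda> (restrict x (co \<Lambda>))). \<not> (AE u in \<kappa> \<Lambda> (restrict x (co \<Lambda>)). g u = 0) \<longrightarrow>
      c \<le> dirichlet_form (\<kappa> \<Lambda> (restrict x (co \<Lambda>))) (cond_gibbs_kernel n X \<kappa> m \<Lambda> (restrict x (co \<Lambda>))) g
        / (L2_norm (\<kappa> \<Lambda> (restrict x (co \<Lambda>))) g)\<^sup>2"
  defines "S \<equiv> \<lambda>x. (\<Sum>\<Gamma>\<in>subblocks. E \<Gamma> f x) / (l choose m)"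
  shows "c * E \<Lambda> (\<lambda>x. (f x - E \<Lambda> f x)\<^sup>2) x \<le>
    E \<Lambda> (\<lambda>x. (f x - E \<Lambda> f x)\<^sup>2) x - E \<Lambda> (\<lambda>x. (f x - E \<Lambda> f x) * (S x - E \<Lambda> f x)) x"
proof -
  let ?k = "\<kappa> \<Lambda> (restrict x (co \<Lambda>))" and ?Q = "cond_gibbs_kernel n X \<kappa> m \<Lambda> (restrict x (co \<Lambda>))"
  note b = block_facts(4)
  interpret k: prob_space ?k by (rule kappa_prob[OF b x])
  have sk: "sets ?k = sets (prod_space X \<Lambda>)" by (rule kappa_sets[OF b x])
  have lm_k: "(\<lambda>u. lift u) \<in> ?k \<rightarrow>\<^sub>M P"
    using lift_measurable by (simp only: measurable_cong_sets[OF sk refl])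
  have mE: "E \<Gamma> f \<in> borel_measurable P" if "block \<Gamma>" for \<Gamma>
    by (rule E_measurable[OF that f])
  have mS: "S \<in> borel_measurable P"
    unfolding S_def by (intro borel_measurable_divide borel_measurable_sum borel_measurable_const mE)
      (use subblocks(4) in blast)
  note lift_m = measurable_compose[OF lm_k]
  define e where "e = E \<Lambda> f x"
  have e: "E \<Lambda> f (lift u) = e" for u
    unfolding e_def by (rule E_merge[OF subset_refl])
  define g where "g = (\<lambda>u. f (lift u) - e)"
  have sqf: "integrable ?k (\<lambda>u. (f (lift u))\<^sup>2)"
    using sq integrable_update[OF b x borel_measurable_power[OF f]] by blast
  have intf: "integrable ?k (\<lambda>u. f (lift u))"
    by (rule k.square_integrable_integrable[OF lift_m[OF f] sqf])
  have mean: "(\<integral>u. f (lift u) \<partial>?k) = e"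
    unfolding e_def integral_update[OF b x f] ..
  have gm: "g \<in> borel_measurable ?k"
    unfolding g_def by (intro borel_measurable_diff lift_m[OF f] borel_measurable_const)
  have g: "g \<in> L02 ?k"
  proof -
    have "(\<lambda>u. (g u)\<^sup>2) = (\<lambda>u. (f (lift u))\<^sup>2 - 2 * e * f (lift u) + e\<^sup>2)"
      by (auto simp: g_def power2_diff)
    then have "integrable ?k (\<lambda>u. (g u)\<^sup>2)" using sqf intf by simp
    moreover have "(\<integral>u. g u \<partial>?k) = 0"
      using intf mean by (simp add: g_def k.prob_space)
    ultimately show ?thesis using gm by (simp add: L02_def)
  qed
  have Qm: "kernel_op ?Q g \<in> borel_measurable ?k"
  proof -
    have "g \<in> borel_measurable (prod_space X \<Lambda>)"
      using gm by (simp only: measurable_cong_sets[OF sk refl])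
    from measurable_compose[OF measurable_prob_algebraD[OF cond_gibbs_measurable]
        integral_measurable_subprob_algebra[OF this]]
    show ?thesis by (simp only: kernel_op_def[abs_def] measurable_cong_sets[OF sk refl])
  qed
  \<comment> \<open>\<open>update \<Lambda> x\<close> is the image of the conditional law under
    \<open>lift\<close>, so an almost sure statement about it pulls back to the fibre.\<close>
  have "AE u in ?k. \<forall>\<Gamma>\<in>subblocks. integrable (update \<Gamma> (lift u)) f"
    by (rule AE_distrD[OF merge_kappa_measurable[OF b x] int[unfolded update_def[of \<Lambda> x]]])
  then have Q: "AE u in ?k. kernel_op ?Q g u = S (lift u) - e"
    using AE_space
  proof eventually_elim
    case (elim u)
    then have "u \<in> space (prod_space X \<Lambda>)" by (simp only: sets_eq_imp_space_eq[OF sk])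
    from cond_gibbs_op[OF this f] elim(1) show ?case unfolding g_def S_def by blast
  qed
  have "AE u in ?k. g u * kernel_op ?Q g u = g u * (S (lift u) - e)"
    using Q by eventually_elim simp
  then have cross: "L2_inner ?k g (kernel_op ?Q g) = (\<integral>u. g u * (S (lift u) - e) \<partial>?k)"
    unfolding L2_inner_def
    by (intro integral_cong_AE borel_measurable_times gm Qm borel_measurable_diff lift_m[OF mS] borel_measurable_const)
  have form: "dirichlet_form ?k ?Q g = L2_inner ?k g g - (\<integral>u. g u * (S (lift u) - e) \<partial>?k)"
    by (simp add: dirichlet_form_def k.L2_norm_square cross)
  have ineq: "c * L2_inner ?k g g \<le> L2_inner ?k g g - (\<integral>u. g u * (S (lift u) - e) \<partial>?k)"
  \<comment> \<open>The gap hypothesis says nothing about the zero class, where f is almost surely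
    constant on the fibre; there both sides are 0.\<close>
  proof (cases "AE u in ?k. g u = 0")
    case True
    have "L2_inner ?k g g = (\<integral>u. 0 \<partial>?k)"
      unfolding L2_inner_def using True by (intro integral_cong_AE borel_measurable_times gm) auto
    moreover have "(\<integral>u. g u * (S (lift u) - e) \<partial>?k) = (\<integral>u. 0 \<partial>?k)"
      using True by (intro integral_cong_AE borel_measurable_times gm borel_measurable_diff
        lift_m[OF mS] borel_measurable_const) auto
    ultimately show ?thesis by simp
  next
    case False
    then have c: "c \<le> dirichlet_form ?k ?Q g / L2_inner ?k g g"
      using gap g by (simp only: k.L2_norm_square) blast
    \<comment> \<open>The hypothesis is a quotient, and division by 0 yields 0, so a positive
      denominator is needed to clear it. A vanishing norm would put g in the zero class.\<close>
    have "L2_inner ?k g g \<noteq> 0"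
    proof
      assume "L2_inner ?k g g = 0"
      then have "(\<integral>u. (g u)\<^sup>2 \<partial>?k) = 0" by (simp add: L2_inner_def power2_eq_square)
      then have "AE u in ?k. (g u)\<^sup>2 = 0"
        using k.L02_square[OF g] by (subst (asm) integral_nonneg_eq_0_iff_AE) auto
      with False show False by simp
    qed
    then have "0 < L2_inner ?k g g" using k.L2_inner_nonneg[of g] by simp
    with c show ?thesis by (simp add: pos_le_divide_eq form)
  qed
  have 1: "E \<Lambda> (\<lambda>x. (f x - E \<Lambda> f x)\<^sup>2) x = L2_inner ?k g g"
    by (subst integral_update[OF b x])
      (intro borel_measurable_power borel_measurable_diff f mE b,
        simp only: e L2_inner_def g_def power2_eq_square)
  have 2: "E \<Lambda> (\<lambda>x. (f x - E \<Lambda> f x) * (S x - E \<Lambda> f x)) x = (\<integral>u. g u * (S (lift u) - e) \<partial>?k)"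
    by (subst integral_update[OF b x])
      (intro borel_measurable_times borel_measurable_diff f mE mS b, simp only: e g_def)
  show ?thesis unfolding 1 2 by (rule ineq)
qed

end

text \<open>The integral of \<open>E \<Lambda> h\<close> equals that of h, so integrating the fibre
  inequality over P leaves inner products with d = f - \<open>E \<Lambda> f\<close>. The projection
  identities then eliminate every mixed term.\<close>

lemma block_gap:
  assumes lm: "1 \<le> m" "m < l" "l < n" and \<Lambda>: "\<Lambda> \<in> blocks l"
    and gap: "AE y in marginal X P (co \<Lambda>). \<forall>g\<in>L02 (\<kappa> \<Lambda> y). \<not> (AE u in \<kappa> \<Lambda> y. g u = 0) \<longrightarrow>
      c \<le> dirichlet_form (\<kappa> \<Lambda> y) (cond_gibbs_kernel n X \<kappa> m \<Lambda> y) g / (L2_norm (\<kappa> \<Lambda> y) g)\<^sup>2"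
    and f: "f \<in> L02 P"
  shows "c * (L2_inner P f f - L2_inner P f (E \<Lambda> f)) \<le>
    L2_inner P f f - (\<Sum>\<Gamma> | \<Gamma> \<subseteq> \<Lambda> \<and> card \<Gamma> = m. L2_inner P f (E \<Gamma> f)) / (l choose m)"
proof -
  let ?B = "{\<Gamma>. \<Gamma> \<subseteq> \<Lambda> \<and> card \<Gamma> = m}"
  \<comment> \<open>The combinatorial facts about \<Lambda> were derived with a base point fixed;
    any point provides them.\<close>
  obtain x0 where "x0 \<in> space P" using not_empty by blast
  note facts = block_facts[OF lm \<Lambda> this] and sub = subblocks[OF lm \<Lambda> this]
  note b = facts(4)
  have bB: "block \<Gamma>" "\<Gamma> \<subseteq> \<Lambda>" if "\<Gamma> \<in> ?B" for \<Gamma> using sub(4)[OF that] by auto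
  interpret K: invariant_kernel P "update \<Lambda>" by (rule invariant_kernel_update[OF b])
  define S where "S = (\<lambda>x. (\<Sum>\<Gamma>\<in>?B. E \<Gamma> f x) / (l choose m))"
  define d where "d = (\<lambda>x. f x - E \<Lambda> f x)"
  have fm: "f \<in> borel_measurable P" by (rule L02_measurable[OF f])
  have Ef: "E \<Lambda> f \<in> L02 P" by (rule E_L02[OF b f])
  have d: "d \<in> L02 P" unfolding d_def by (rule L02_diff[OF f Ef])
  have S_eq: "S = (\<lambda>x. inverse (l choose m) * (\<Sum>\<Gamma>\<in>?B. E \<Gamma> f x))"
    by (simp add: S_def divide_inverse mult.commute)
  have sumL: "(\<lambda>x. \<Sum>\<Gamma>\<in>?B. E \<Gamma> f x) \<in> L02 P"
    by (intro L02_sum sub(1) E_L02 bB(1) f)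
  have S: "S \<in> L02 P" unfolding S_eq by (rule L02_scale[OF sumL])
  have SE: "(\<lambda>x. S x - E \<Lambda> f x) \<in> L02 P" by (rule L02_diff[OF S Ef])
  have inner_S: "L2_inner P h S = (\<Sum>\<Gamma>\<in>?B. L2_inner P h (E \<Gamma> f)) / (l choose m)" if h: "h \<in> L02 P" for h
    unfolding S_eq L2_inner_scale_right using L2_inner_sum[OF sub(1) E_L02[OF bB(1) f] h]
    by (simp add: L2_inner_commute[of h] divide_inverse mult.commute)
  have int1: "integrable P (\<lambda>x. (d x)\<^sup>2)" by (rule L02_square[OF d])
  have int2: "integrable P (\<lambda>x. d x * (S x - E \<Lambda> f x))" by (rule L02_mult[OF d SE])
  \<comment> \<open>Integrability under \<open>update \<Gamma>\<close> holds off a P-null set.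
    Invariance under \<open>update \<Lambda>\<close> makes that set null on almost every fibre as
    well.\<close>
  have "AE x in P. \<forall>\<Gamma>\<in>?B. AE x' in update \<Lambda> x. integrable (update \<Gamma> x') f"
  proof (rule AE_finite_allI[OF sub(1)])
    fix \<Gamma> assume \<Gamma>: "\<Gamma> \<in> ?B"
    interpret L: invariant_kernel P "update \<Gamma>" by (rule invariant_kernel_update[OF bB(1)[OF \<Gamma>]])
    have "Measurable.pred P (\<lambda>x. integrable (update \<Gamma> x) f)"
      by (rule measurable_compose[OF L.K_subprob integrable_measurable_subprob_algebra[OF fm]])
    then show "AE x in P. AE x' in update \<Lambda> x. integrable (update \<Gamma> x') f"
      by (rule K.AE_AE_K[OF _ L.AE_integrable_K[OF L02_integrable[OF f]]])
  qed
  moreover have "AE x in P. integrable (update \<Lambda> x) (\<lambda>x. (f x)\<^sup>2)"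
    by (rule K.AE_integrable_K[OF L02_square[OF f]])
  moreover have "AE x in P. \<forall>g\<in>L02 (\<kappa> \<Lambda> (restrict x (co \<Lambda>))). \<not> (AE u in \<kappa> \<Lambda> (restrict x (co \<Lambda>)). g u = 0) \<longrightarrow>
      c \<le> dirichlet_form (\<kappa> \<Lambda> (restrict x (co \<Lambda>))) (cond_gibbs_kernel n X \<kappa> m \<Lambda> (restrict x (co \<Lambda>))) g
        / (L2_norm (\<kappa> \<Lambda> (restrict x (co \<Lambda>))) g)\<^sup>2"
    by (rule AE_distrD[OF restrict_measurable_P gap[unfolded marginal_def]])
  ultimately have AE: "AE x in P. c * E \<Lambda> (\<lambda>x. (d x)\<^sup>2) x \<le>
      E \<Lambda> (\<lambda>x. (d x)\<^sup>2) x - E \<Lambda> (\<lambda>x. d x * (S x - E \<Lambda> f x)) x"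
    using AE_space
  proof eventually_elim
    case (elim x)
    have "AE x' in update \<Lambda> x. \<forall>\<Gamma>\<in>?B. integrable (update \<Gamma> x') f"
      by (rule AE_finite_allI[OF sub(1)]) (use elim(1) in blast)
    from fibre_gap[OF lm \<Lambda> elim(4) fm elim(2) this elim(3)] show ?case
      unfolding d_def S_def .
  qed
  have "(\<integral>x. c * E \<Lambda> (\<lambda>x. (d x)\<^sup>2) x \<partial>P) \<le>
      (\<integral>x. E \<Lambda> (\<lambda>x. (d x)\<^sup>2) x - E \<Lambda> (\<lambda>x. d x * (S x - E \<Lambda> f x)) x \<partial>P)"
    by (intro integral_mono_AE AE Bochner_Integration.integrable_diff integrable_mult_right
      K.integrable_op int1 int2)
  then have "c * (\<integral>x. (d x)\<^sup>2 \<partial>P) \<le> (\<integral>x. (d x)\<^sup>2 \<partial>P) - (\<integral>x. d x * (S x - E \<Lambda> f x) \<partial>P)"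
    by (simp add: K.integrable_op K.integral_op int1 int2)
  then have main: "c * L2_inner P d d \<le> L2_inner P d d - L2_inner P d (\<lambda>x. S x - E \<Lambda> f x)"
    by (simp add: L2_inner_def power2_eq_square)
  have ee: "L2_inner P (E \<Lambda> f) (E \<Lambda> f) = L2_inner P f (E \<Lambda> f)"
    using E_inner[OF b f f] by (simp add: L2_inner_commute)
  have eS: "L2_inner P (E \<Lambda> f) S = L2_inner P f (E \<Lambda> f)"
  proof -
    have "L2_inner P (E \<Lambda> f) (E \<Gamma> f) = L2_inner P f (E \<Lambda> f)" if "\<Gamma> \<in> ?B" for \<Gamma>
      using E_inner_nested[OF bB(1)[OF that] b bB(2)[OF that] f f] by (simp add: L2_inner_commute)
    then have "L2_inner P (E \<Lambda> f) S = real (card ?B) * L2_inner P f (E \<Lambda> f) / (l choose m)"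
      unfolding inner_S[OF Ef] by simp
    then show ?thesis unfolding sub(3) using lm by simp
  qed
  have dd: "L2_inner P d d = L2_inner P f f - L2_inner P f (E \<Lambda> f)"
    using ee unfolding d_def by (simp add: L2_inner_diff L2_inner_diff_right f Ef L02_diff
      L2_inner_commute[of "E \<Lambda> f" f])
  \<comment> \<open>\<open>E \<Lambda> f\<close> has the same inner product with S as with itself,
    so it is orthogonal to S - \<open>E \<Lambda> f\<close>. Hence d can be replaced by f here, and
    the terms in \<open>E \<Lambda> f\<close> on the right side of \<open>main\<close>
    cancel.\<close>
  have dS: "L2_inner P d (\<lambda>x. S x - E \<Lambda> f x) = L2_inner P f S - L2_inner P f (E \<Lambda> f)"
    using ee eS unfolding d_def by (simp add: L2_inner_diff L2_inner_diff_right f Ef S L02_diff)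
  show ?thesis using main unfolding dd dS inner_S[OF f] by simp
qed

lemma T_gap:
  assumes lm: "1 \<le> m" "m < l" "l < n"
    and gap: "\<And>\<Lambda>. \<Lambda> \<in> blocks l \<Longrightarrow>
      AE y in marginal X P (co \<Lambda>). \<forall>g\<in>L02 (\<kappa> \<Lambda> y). \<not> (AE u in \<kappa> \<Lambda> y. g u = 0) \<longrightarrow>
        c \<le> dirichlet_form (\<kappa> \<Lambda> y) (cond_gibbs_kernel n X \<kappa> m \<Lambda> y) g / (L2_norm (\<kappa> \<Lambda> y) g)\<^sup>2"
    and f: "f \<in> L02 P"
  shows "c * dirichlet_form P (T l) f \<le> dirichlet_form P (T m) f"
proof -
  let ?F = "L2_inner P f f" and ?N = "real (n choose l)"
  let ?a = "\<lambda>\<Lambda>. L2_inner P f (E \<Lambda> f)"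
  let ?b = "\<lambda>\<Lambda>. (\<Sum>\<Gamma> | \<Gamma> \<subseteq> \<Lambda> \<and> card \<Gamma> = m. ?a \<Gamma>) / (l choose m)"
  have N: "0 < ?N" using lm by simp
  have "(\<Sum>\<Lambda>\<in>blocks l. c * (?F - ?a \<Lambda>)) \<le> (\<Sum>\<Lambda>\<in>blocks l. ?F - ?b \<Lambda>)"
    by (intro sum_mono block_gap lm gap f)
  then have "c * (?N * ?F - (\<Sum>\<Lambda>\<in>blocks l. ?a \<Lambda>)) \<le> ?N * ?F - (\<Sum>\<Lambda>\<in>blocks l. ?b \<Lambda>)"
    by (simp only: sum_distrib_left[symmetric] sum_subtractf sum_constant card_blocks)
  from divide_right_mono[OF this, of ?N]
  have "c * (?F - (\<Sum>\<Lambda>\<in>blocks l. ?a \<Lambda>) / ?N) \<le> ?F - (\<Sum>\<Lambda>\<in>blocks l. ?b \<Lambda>) / ?N"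
    using N by (simp add: diff_divide_distrib right_diff_distrib)
  \<comment> \<open>The two-stage average over blocks and their m-subsets is the one-stage average
    that defines the form of T_m.\<close>
  also have "(\<Sum>\<Lambda>\<in>blocks l. ?b \<Lambda>) / ?N = (\<Sum>\<Gamma>\<in>blocks m. ?a \<Gamma>) / (n choose m)"
    using lm by (intro average_blocks) auto
  finally show ?thesis
    using lm f by (simp add: dirichlet_form_def L2_norm_square T_form)
qed

end

theorem corollary19:
  fixes n l m :: nat
    and X :: "nat \<Rightarrow> 'a topology"
    and P :: "(nat \<Rightarrow> 'a) measure"
    and \<kappa> :: "nat set \<Rightarrow> (nat \<Rightarrow> 'a) \<Rightarrow> (nat \<Rightarrow> 'a) measure"
    and c\<^sub>1 :: real
  assumes polish: "\<And>i. i \<in> {1..n} \<Longrightarrow> polish_topology (X i)"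
    and prob: "prob_space P"
    and sets_P: "sets P = sets (prod_space X {1..n})"
    and cond: "\<And>\<Lambda>. \<Lambda> \<subseteq> {1..n} \<Longrightarrow> 1 \<le> card \<Lambda> \<Longrightarrow> card \<Lambda> < n \<Longrightarrow> is_cond_distr n X P \<Lambda> (\<kappa> \<Lambda>)"
    and lm: "1 \<le> m" "m < l" "l < n"
    and c1: "c\<^sub>1 \<in> {0..1}"
    and gap: "\<And>\<Lambda>. \<Lambda> \<subseteq> {1..n} \<Longrightarrow> card \<Lambda> = l \<Longrightarrow>
      (AE y in marginal X P ({1..n} - \<Lambda>).
         \<forall>g\<in>L02 (\<kappa> \<Lambda> y). \<not> (AE u in \<kappa> \<Lambda> y. g u = 0) \<longrightarrow>
           c\<^sub>1 \<le> dirichlet_form (\<kappa> \<Lambda> y) (cond_gibbs_kernel n X \<kappa> m \<Lambda> y) g / (L2_norm (\<kappa> \<Lambda> y) g)\<^sup>2)"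
  shows "c\<^sub>1 * (1 - kernel_norm P (gibbs_kernel n X \<kappa> l)) \<le> 1 - kernel_norm P (gibbs_kernel n X \<kappa> m) \<and>
    1 - kernel_norm P (gibbs_kernel n X \<kappa> m) \<le> 1 - kernel_norm P (gibbs_kernel n X \<kappa> l) \<and>
    (kernel_norm P (gibbs_kernel n X \<kappa> l) < 1 \<and> 0 < c\<^sub>1 \<longrightarrow>
      (\<forall>f\<in>L02 P.
         asymp_var P (gibbs_kernel n X \<kappa> l) f \<le> asymp_var P (gibbs_kernel n X \<kappa> m) f \<and>
         asymp_var P (gibbs_kernel n X \<kappa> m) f
           \<le> inverse c\<^sub>1 * asymp_var P (gibbs_kernel n X \<kappa> l) f
              + (inverse c\<^sub>1 - 1) * (L2_norm P f)\<^sup>2))"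
proof -
  interpret gibbs n X P \<kappa>
    by (rule gibbs.intro[OF prob sets_P cond])
  have m: "m < n" "1 \<le> l" using lm by auto
  \<comment> \<open>In the comparison lemmas K is T_m, with the smaller Dirichlet form, and L is
    T_l.\<close>
  note K = positive_kernel_T[OF lm(1) m(1)] and L = positive_kernel_T[OF m(2) lm(3)]
  have lower: "c\<^sub>1 * dirichlet_form P (T l) f \<le> dirichlet_form P (T m) f" if f: "f \<in> L02 P" for f
  proof (rule T_gap[OF lm _ f])
    fix \<Lambda> assume "\<Lambda> \<in> blocks l"
    then have "\<Lambda> \<subseteq> {1..n}" "card \<Lambda> = l" by (simp_all add: blocks_def)
    then show "AE y in marginal X P (co \<Lambda>). \<forall>g\<in>L02 (\<kappa> \<Lambda> y). \<not> (AE u in \<kappa> \<Lambda> y. g u = 0) \<longrightarrow>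
        c\<^sub>1 \<le> dirichlet_form (\<kappa> \<Lambda> y) (cond_gibbs_kernel n X \<kappa> m \<Lambda> y) g / (L2_norm (\<kappa> \<Lambda> y) g)\<^sup>2"
      by (rule gap[of \<Lambda>])
  qed
  have upper: "dirichlet_form P (T m) f \<le> dirichlet_form P (T l) f" if "f \<in> L02 P" for f
    using T_form_antimono[OF lm that] by (simp add: dirichlet_form_def)
  show ?thesis
    by (intro conjI impI ballI kernel_norm_comparison[OF K L c1 lower upper]
      asymp_var_comparison[OF K L c1 lower upper]) auto
qed

end
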